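(* For each $\mathfrak{F}$-stopping time $\sigma$ it holds (almost surely) that $$Z_{n}^{\delta,\mathfrak{F}}(\sigma)= \operatorname*{ess\,sup}_{\tau\in \mathcal{S}_\sigma} \; \mathbb{E}\Bigl( Y(\tau)+ \mathbb{E}\bigl(Z_{n-1}^{L\delta,\mathfrak{F}^{\tau+\delta_1}}(\tau+\delta_1)\,\big|\,\mathcal{F}_\tau \bigr)\,\Big|\,\mathcal{F}_\sigma \Bigr)$$ and $$Z_{n}^{\delta,\mathfrak{F}}(\sigma)_{\mathrm{disc}}= \operatorname*{ess\,sup}_{\tau\in \mathcal{S}_{\sigma,\mathrm{disc}}} \; \mathbb{E}\Bigl( Y(\tau)+ \mathbb{E}\bigl(Z_{n-1}^{L\delta,\mathfrak{F}^{\tau+\delta_1}}(\tau+\delta_1)\,\big|\,\mathcal{F}_\tau \bigr)\,\Big|\,\mathcal{F}_\sigma \Bigr).$$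
   Context: $(\Omega,\mathcal{F},\mathbb{P})$ is a probability space with a filtration $\mathfrak{F}=(\mathcal{F}_t)_{t\ge 0}$ satisfying the usual conditions (right-continuous, $\mathcal{F}_0$ contains all $\mathbb{P}$-null sets); $\mathcal{F}_\infty=\sigma(\bigcup_{t\ge0}\mathcal{F}_t)$. Stopping times take values in $[0,\infty]$. $Y=(Y(t))_{t\ge0}$ is an $\mathfrak{F}$-adapted, non-negative, right-continuous process with $\mathbb{E}(\sup_{t\ge0}Y(t))<\infty$, and $Y(+\infty):=\limsup_{t\to\infty}Y(t)$. $n\ge 1$ is a fixed integer; $\delta=(\delta_1,\dots,\delta_{n-1})$ are non-negative, a.s. finite random variables (not necessarily related to $\mathfrak{F}$), and $L\delta:=(\delta_2,\dots,\delta_{n-1})$. Enlarged filtrations: for a filtration $\mathfrak{A}=(\mathcal{A}_t)_{t\ge0}$ and $\rho:\Omega\to[0,\infty]$, $\mathfrak{A}^\rho=(\mathcal{A}^\rho_t)_{t\ge0}$ is the smallest right-continuous filtration containing $\mathfrak{A}$ for which $\rho$ is a stopping time, i.e. the right-continuous filtration generated by $\bigl(\sigma(\mathcal{A}_t\cup\{\{\rho\le s\}: s\le t\})\bigr)_{t\ge0}$. Recursively $\mathfrak{A}^{\rho_1,\dots,\rho_i}=(\mathfrak{A}^{\rho_1,\dots,\rho_{i-1}})^{\rho_i}$. Strategies: for $\mathfrak{A}$ equal to $\mathfrak{F}$ or such an enlargement of it, $m\ge1$, waiting times $\gamma=(\gamma_1,\dots,\gamma_{m-1})$ and an $\mathfrak{A}$-stopping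 time $\sigma$, $\mathcal{S}^m_\sigma(\gamma,\mathfrak{A})$ is the set of all $(\tau_1,\dots,\tau_m)$ such that $\tau_1$ is an $\mathfrak{A}$-stopping time with $\sigma\le\tau_1$ and, for $i=2,\dots,m$, $\tau_i$ is an $\mathfrak{A}^{\tau_1+\gamma_1,\dots,\tau_{i-1}+\gamma_{i-1}}$-stopping time with $\tau_{i-1}+\gamma_{i-1}\le\tau_i$. $\mathcal{S}^m_\sigma(\gamma,\mathfrak{A})_{\mathrm{disc}}$ is the subset of those with $\tau_1$ of countable range. $\mathcal{S}_\sigma$ is the set of $\mathfrak{F}$-stopping times $\tau\ge\sigma$, and $\mathcal{S}_{\sigma,\mathrm{disc}}$ the subset of those with countable range. Values: $Z_m^{\gamma,\mathfrak{A}}(\sigma):=\operatorname*{ess\,sup}_{\tau\in\mathcal{S}^m_\sigma(\gamma,\mathfrak{A})}\mathbb{E}\bigl(\sum_{i=1}^mY(\tau_i)\,|\,\mathcal{A}_\sigma\bigr)$, and $Z_m^{\gamma,\mathfrak{A}}(\sigma)_{\mathrm{disc}}$ is defined in the same way with $\mathcal{S}^m_\sigma(\gamma,\mathfrak{A})_{\mathrm{disc}}$ in place of $\mathcal{S}^m_\sigma(\gamma,\mathfrak{A})$. $Z_0\equiv0$, so for $n=1$ the terms with $Z_{n-1}$ are $0$. *)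

theory Defs
  imports "HOL-Probability.Probability"
begin

section \<open>Filtrations on the time axis [0,\<infinity>]\<close>

text \<open>
  The time axis is \<^typ>\<open>ennreal\<close>, so that the library notions \<^const>\<open>stopping_time\<close> and
  \<open>filtration.pre_sigma\<close> apply to stopping times with values in \<open>[0,\<infinity>]\<close>.  The value of a
  filtration at \<open>\<infinity>\<close> is no extra datum: it is always required to be (or defined as) the
  sigma-algebra generated by its values at finite times.  At \<open>t = \<infinity>\<close> the condition in
  \<open>pre_sigma T\<close> therefore says that the event belongs to the terminal sigma-algebra.
  Measures representing sub-sigma-algebras only matter through their space and their sets.
\<close>

definition right_continuous_filtration :: "(ennreal \<Rightarrow> 'a measure) \<Rightarrow> bool" where
  "right_continuous_filtration F \<longleftrightarrow> (\<forall>t<\<infinity>. sets (F t) = (\<Inter>u\<in>{t<..<\<infinity>}. sets (F u)))"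

locale usual_filtered_prob_space =
  prob_space M + filtration "space M" F
  for M :: "'a measure" and F :: "ennreal \<Rightarrow> 'a measure" +
  assumes sets_F_subset: "\<And>t. sets (F t) \<subseteq> sets M"
    and right_continuous_F: "right_continuous_filtration F"
    and null_sets_F: "null_sets M \<subseteq> sets (F 0)"
    and sets_F_infinity: "sets (F \<infinity>) = sigma_sets (space M) (\<Union>t\<in>{..<\<infinity>}. sets (F t))"

text \<open>
  \<open>adjoin_time \<Omega> A \<rho>\<close> makes \<open>\<rho>\<close> a stopping time without regularisation; \<open>enlarge \<Omega> A \<rho>\<close> is the
  right-continuous filtration generated by it.
\<close>

definition adjoin_time ::
  "'a set \<Rightarrow> (ennreal \<Rightarrow> 'a measure) \<Rightarrow> ('a \<Rightarrow> ennreal) \<Rightarrow> ennreal \<Rightarrow> 'a measure" where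
  "adjoin_time \<Omega> A \<rho> t = sigma \<Omega> (sets (A t) \<union> {{\<omega>\<in>\<Omega>. \<rho> \<omega> \<le> s} | s. s \<le> t})"

definition enlarge ::
  "'a set \<Rightarrow> (ennreal \<Rightarrow> 'a measure) \<Rightarrow> ('a \<Rightarrow> ennreal) \<Rightarrow> ennreal \<Rightarrow> 'a measure" where
  "enlarge \<Omega> A \<rho> t =
     (if t < \<infinity> then sigma \<Omega> (\<Inter>u\<in>{t<..<\<infinity>}. sets (adjoin_time \<Omega> A \<rho> u))
      else sigma \<Omega> (\<Union>u\<in>{..<\<infinity>}. sets (adjoin_time \<Omega> A \<rho> u)))"

text \<open>\<open>enlarge\<close> is the least right-continuous filtration containing \<open>A\<close> with \<open>\<rho>\<close> as stopping time;
  see \<open>stopping_time_enlarge\<close> and \<open>enlarge_least\<close>.\<close>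

lemma adjoin_time_Pow:
  assumes "filtration \<Omega> A"
  shows "sets (A t) \<union> {{\<omega>\<in>\<Omega>. \<rho> \<omega> \<le> s} | s. s \<le> t} \<subseteq> Pow \<Omega>"
  using sets.space_closed[of "A t"] filtration.space_F[OF assms] by auto

lemma filtration_adjoin_time:
  assumes "filtration \<Omega> A"
  shows "filtration \<Omega> (adjoin_time \<Omega> A \<rho>)"
proof
  show "space (adjoin_time \<Omega> A \<rho> t) = \<Omega>" for t
    unfolding adjoin_time_def by (rule space_measure_of[OF adjoin_time_Pow[OF assms]])
  show "sets (adjoin_time \<Omega> A \<rho> s) \<subseteq> sets (adjoin_time \<Omega> A \<rho> t)" if "s \<le> t" for s t
    unfolding adjoin_time_def sets_measure_of[OF adjoin_time_Pow[OF assms]]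
    using filtration.sets_F_mono[OF assms that] that
    by (intro sigma_sets_mono') (auto intro: order_trans)
qed

lemma sets_enlarge:
  assumes "filtration \<Omega> A"
  shows "t < \<infinity> \<Longrightarrow> sets (enlarge \<Omega> A \<rho> t) = (\<Inter>u\<in>{t<..<\<infinity>}. sets (adjoin_time \<Omega> A \<rho> u))"
    and "sets (enlarge \<Omega> A \<rho> \<infinity>) = sigma_sets \<Omega> (\<Union>u\<in>{..<\<infinity>}. sets (adjoin_time \<Omega> A \<rho> u))"
    and "space (enlarge \<Omega> A \<rho> r) = \<Omega>"
proof -
  interpret G: filtration \<Omega> "adjoin_time \<Omega> A \<rho>" by (rule filtration_adjoin_time[OF assms])
  let ?I = "\<lambda>t. \<Inter>u\<in>{t<..<\<infinity>}. sets (adjoin_time \<Omega> A \<rho> u)"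
  have U: "(\<Union>u\<in>{..<\<infinity>}. sets (adjoin_time \<Omega> A \<rho> u)) \<subseteq> Pow \<Omega>"
    using sets.space_closed[of "adjoin_time \<Omega> A \<rho> _"] by (auto simp: G.space_F)
  have ne: "{t<..<\<infinity>} \<noteq> {}" if "t < \<infinity>" for t :: ennreal
    using dense[OF that] by auto
  have I: "sigma_algebra \<Omega> (?I t)" if t: "t < \<infinity>" for t
  proof -
    obtain v where v: "v \<in> {t<..<\<infinity>}" using ne[OF t] by blast
    show ?thesis
      unfolding sigma_algebra_iff2
    proof (intro conjI ballI allI impI INT_I)
      show "?I t \<subseteq> Pow \<Omega>"
        using v sets.space_closed[of "adjoin_time \<Omega> A \<rho> v"] unfolding G.space_F by blast
    next
      fix s u assume "s \<in> ?I t" "u \<in> {t<..<\<infinity>}"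
      then show "\<Omega> - s \<in> sets (adjoin_time \<Omega> A \<rho> u)"
        using sets.compl_sets[of s "adjoin_time \<Omega> A \<rho> u"] by (auto simp: G.space_F)
    qed (auto intro!: sets.countable_UN)
  qed
  show "t < \<infinity> \<Longrightarrow> sets (enlarge \<Omega> A \<rho> t) = ?I t"
    using sigma_algebra.sets_measure_of_eq[OF I] by (simp only: enlarge_def if_True)
  show "sets (enlarge \<Omega> A \<rho> \<infinity>) = sigma_sets \<Omega> (\<Union>u\<in>{..<\<infinity>}. sets (adjoin_time \<Omega> A \<rho> u))"
    using sets_measure_of[OF U] by (simp add: enlarge_def)
  show "space (enlarge \<Omega> A \<rho> r) = \<Omega>"
    using sigma_algebra.space_measure_of_eq[OF I[of r]] space_measure_of[OF U]
    by (simp only: enlarge_def split: if_split) blast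
qed

lemma
  assumes "filtration \<Omega> A"
  shows filtration_enlarge: "filtration \<Omega> (enlarge \<Omega> A \<rho>)"
    and right_continuous_enlarge: "right_continuous_filtration (enlarge \<Omega> A \<rho>)"
    and sets_enlarge_infinity:
      "sets (enlarge \<Omega> A \<rho> \<infinity>) = sigma_sets \<Omega> (\<Union>t\<in>{..<\<infinity>}. sets (enlarge \<Omega> A \<rho> t))"
    and sets_subset_enlarge: "t < \<infinity> \<Longrightarrow> sets (A t) \<subseteq> sets (enlarge \<Omega> A \<rho> t)"
    and stopping_time_enlarge: "stopping_time (enlarge \<Omega> A \<rho>) \<rho>"
    and enlarge_least:
      "\<lbrakk>filtration \<Omega> B; right_continuous_filtration B; \<And>t. sets (A t) \<subseteq> sets (B t);
        stopping_time B \<rho>\<rbrakk> \<Longrightarrow> sets (enlarge \<Omega> A \<rho> t) \<subseteq> sets (B t)"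
proof -
  let ?G = "adjoin_time \<Omega> A \<rho>" and ?E = "enlarge \<Omega> A \<rho>"
  interpret G: filtration \<Omega> ?G by (rule filtration_adjoin_time[OF assms])
  note E = sets_enlarge[OF assms, where \<rho> = \<rho>]
  have sets_G: "sets (?G t) = sigma_sets \<Omega> (sets (A t) \<union> {{\<omega>\<in>\<Omega>. \<rho> \<omega> \<le> s} | s. s \<le> t})" for t
    unfolding adjoin_time_def by (rule sets_measure_of[OF adjoin_time_Pow[OF assms]])
  have G_E: "sets (?G t) \<subseteq> sets (?E t)" if "t < \<infinity>" for t
    unfolding E(1)[OF that] by (intro INT_greatest G.sets_F_mono) (simp add: less_imp_le)
  have E_G: "sets (?E s) \<subseteq> sets (?G t)" if "s < t" "t < \<infinity>" for s t
  proof -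
    have "s < \<infinity>" using that by (rule less_trans)
    then show ?thesis unfolding E(1)[OF \<open>s < \<infinity>\<close>] using that by (intro INT_lower) simp
  qed
  show inf: "sets (?E \<infinity>) = sigma_sets \<Omega> (\<Union>t\<in>{..<\<infinity>}. sets (?E t))"
  proof
    show "sets (?E \<infinity>) \<subseteq> sigma_sets \<Omega> (\<Union>t\<in>{..<\<infinity>}. sets (?E t))"
      unfolding E(2) using G_E by (intro sigma_sets_mono') blast
    have "(\<Union>t\<in>{..<\<infinity>}. sets (?E t)) \<subseteq> (\<Union>t\<in>{..<\<infinity>}. sets (?G t))"
    proof (rule UN_least)
      fix t :: ennreal assume "t \<in> {..<\<infinity>}"
      then obtain u where "t < u" "u < \<infinity>" using dense by auto
      with E_G show "sets (?E t) \<subseteq> (\<Union>t\<in>{..<\<infinity>}. sets (?G t))" by blast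
    qed
    then show "sigma_sets \<Omega> (\<Union>t\<in>{..<\<infinity>}. sets (?E t)) \<subseteq> sets (?E \<infinity>)"
      unfolding E(2) by (rule sigma_sets_mono')
  qed
  have E_mono: "sets (?E s) \<subseteq> sets (?E t)" if "s \<le> t" for s t
  proof (cases "t < \<infinity>")
    case True
    with that have "s < \<infinity>" by order
    show ?thesis
      unfolding E(1)[OF True] E(1)[OF \<open>s < \<infinity>\<close>] using that by (intro INT_anti_mono) auto
  next
    case False
    then have "t = \<infinity>" by (simp add: not_less top_unique)
    show ?thesis
    proof (cases "s < \<infinity>")
      case True
      then have "sets (?E s) \<subseteq> (\<Union>t\<in>{..<\<infinity>}. sets (?E t))" by (intro UN_upper) simp
      also have "\<dots> \<subseteq> sets (?E \<infinity>)" unfolding inf by (rule sigma_sets_superset_generator)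
      finally show ?thesis unfolding \<open>t = \<infinity>\<close> .
    qed (simp add: \<open>t = \<infinity>\<close> not_less top_unique)
  qed
  show "filtration \<Omega> ?E" by (rule filtration.intro[OF E(3) E_mono])
  show "right_continuous_filtration ?E"
    unfolding right_continuous_filtration_def
  proof (intro allI impI antisym)
    fix t :: ennreal assume t: "t < \<infinity>"
    show "sets (?E t) \<subseteq> (\<Inter>u\<in>{t<..<\<infinity>}. sets (?E u))"
      by (intro INT_greatest E_mono) auto
    show "(\<Inter>u\<in>{t<..<\<infinity>}. sets (?E u)) \<subseteq> sets (?E t)"
      unfolding E(1)[OF t]
    proof (rule INT_greatest)
      fix u assume u: "u \<in> {t<..<\<infinity>}"
      then obtain v where v: "t < v" "v < u" using dense by auto
      with u have "v \<in> {t<..<\<infinity>}" by (auto intro: less_trans)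
      then have "(\<Inter>u\<in>{t<..<\<infinity>}. sets (?E u)) \<subseteq> sets (?E v)" by blast
      also have "\<dots> \<subseteq> sets (?G u)" using u v by (intro E_G) auto
      finally show "(\<Inter>u\<in>{t<..<\<infinity>}. sets (?E u)) \<subseteq> sets (?G u)" .
    qed
  qed
  show "sets (A t) \<subseteq> sets (?E t)" if "t < \<infinity>"
    using G_E[OF that] by (auto simp: sets_G)
  show "stopping_time ?E \<rho>"
  proof
    fix t
    have "{\<omega>\<in>\<Omega>. \<rho> \<omega> \<le> t} \<in> sets (?E t)"
    proof (cases "t < \<infinity>")
      case True
      have "{\<omega>\<in>\<Omega>. \<rho> \<omega> \<le> t} \<in> sets (?G t)" by (auto simp: sets_G)
      with G_E[OF True] show ?thesis by blast
    next
      case False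
      then have "{\<omega>\<in>\<Omega>. \<rho> \<omega> \<le> t} = space (?E t)" by (auto simp: E(3) not_less top_unique)
      then show ?thesis by (metis sets.top)
    qed
    then show "Measurable.pred (?E t) (\<lambda>\<omega>. \<rho> \<omega> \<le> t)" by (simp add: pred_def E(3))
  qed
  show "sets (?E t) \<subseteq> sets (B t)"
    if B: "filtration \<Omega> B" "right_continuous_filtration B" "\<And>t. sets (A t) \<subseteq> sets (B t)"
      "stopping_time B \<rho>" for B
  proof -
    interpret B: filtration \<Omega> B by fact
    have G_B: "sets (?G u) \<subseteq> sets (B u)" for u
    proof -
      have "{\<omega>\<in>\<Omega>. \<rho> \<omega> \<le> s} \<in> sets (B u)" if "s \<le> u" for s
        using B.stopping_time_le_const[OF B(4) that] by (simp add: pred_def B.space_F)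
      then have "sets (A u) \<union> {{\<omega>\<in>\<Omega>. \<rho> \<omega> \<le> s} | s. s \<le> u} \<subseteq> sets (B u)"
        using B(3)[of u] by blast
      from sets.sigma_sets_subset[OF this] show ?thesis unfolding sets_G B.space_F .
    qed
    show ?thesis
    proof (cases "t < \<infinity>")
      case True
      with B(2) have "sets (B t) = (\<Inter>u\<in>{t<..<\<infinity>}. sets (B u))"
        by (simp add: right_continuous_filtration_def)
      with G_B show ?thesis unfolding E(1)[OF True] by (simp only:) (intro INF_mono')
    next
      case False
      then have t: "t = \<infinity>" by (simp add: not_less top_unique)
      have "(\<Union>u\<in>{..<\<infinity>}. sets (?G u)) \<subseteq> sets (B \<infinity>)"
        by (intro UN_least order_trans[OF G_B] B.sets_F_mono) simp
      from sets.sigma_sets_subset[OF this] show ?thesis unfolding t E(2) B.space_F .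
    qed
  qed
qed

text \<open>Successive enlargement by \<open>\<rho>\<^sub>1, \<dots>, \<rho>\<^sub>i\<close>, the last one being adjoined last.\<close>

definition enlarges ::
  "'a set \<Rightarrow> (ennreal \<Rightarrow> 'a measure) \<Rightarrow> ('a \<Rightarrow> ennreal) list \<Rightarrow> ennreal \<Rightarrow> 'a measure" where
  "enlarges \<Omega> A \<rho>s = foldl (enlarge \<Omega>) A \<rho>s"

section \<open>Strategies\<close>

text \<open>
  Tuples are lists, so indices are shifted by one: \<open>\<tau> ! i\<close> is the \<open>(i+1)\<close>-st stopping time
  and \<open>\<gamma> ! i\<close> the waiting time following it.
\<close>

definition strategies ::
  "'a set \<Rightarrow> nat \<Rightarrow> ('a \<Rightarrow> ennreal) list \<Rightarrow> (ennreal \<Rightarrow> 'a measure) \<Rightarrow> ('a \<Rightarrow> ennreal)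
    \<Rightarrow> ('a \<Rightarrow> ennreal) list set" where
  "strategies \<Omega> m \<gamma> A \<sigma> =
     {\<tau>. length \<tau> = m \<and>
         stopping_time A (\<tau> ! 0) \<and> (\<forall>\<omega>\<in>\<Omega>. \<sigma> \<omega> \<le> (\<tau> ! 0) \<omega>) \<and>
         (\<forall>i\<in>{1..<m}.
            stopping_time (enlarges \<Omega> A (map (\<lambda>j \<omega>. (\<tau> ! j) \<omega> + (\<gamma> ! j) \<omega>) [0..<i])) (\<tau> ! i) \<and>
            (\<forall>\<omega>\<in>\<Omega>. (\<tau> ! (i - 1)) \<omega> + (\<gamma> ! (i - 1)) \<omega> \<le> (\<tau> ! i) \<omega>))}"

definition strategies_disc ::
  "'a set \<Rightarrow> nat \<Rightarrow> ('a \<Rightarrow> ennreal) list \<Rightarrow> (ennreal \<Rightarrow> 'a measure) \<Rightarrow> ('a \<Rightarrow> ennreal)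
    \<Rightarrow> ('a \<Rightarrow> ennreal) list set" where
  "strategies_disc \<Omega> m \<gamma> A \<sigma> = {\<tau>\<in>strategies \<Omega> m \<gamma> A \<sigma>. countable ((\<tau> ! 0) ` \<Omega>)}"

definition stopping_times_ge ::
  "'a set \<Rightarrow> (ennreal \<Rightarrow> 'a measure) \<Rightarrow> ('a \<Rightarrow> ennreal) \<Rightarrow> ('a \<Rightarrow> ennreal) set" where
  "stopping_times_ge \<Omega> F \<sigma> = {\<tau>. stopping_time F \<tau> \<and> (\<forall>\<omega>\<in>\<Omega>. \<sigma> \<omega> \<le> \<tau> \<omega>)}"

definition stopping_times_ge_disc ::
  "'a set \<Rightarrow> (ennreal \<Rightarrow> 'a measure) \<Rightarrow> ('a \<Rightarrow> ennreal) \<Rightarrow> ('a \<Rightarrow> ennreal) set" where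
  "stopping_times_ge_disc \<Omega> F \<sigma> = {\<tau>\<in>stopping_times_ge \<Omega> F \<sigma>. countable (\<tau> ` \<Omega>)}"

section \<open>Essential supremum of a family of random variables\<close>

text \<open>Not to be confused with \<^const>\<open>esssup\<close>, which is a number attached to a single function.\<close>

definition is_ess_sup :: "'a measure \<Rightarrow> ('a \<Rightarrow> ennreal) set \<Rightarrow> ('a \<Rightarrow> ennreal) \<Rightarrow> bool" where
  "is_ess_sup M \<Phi> Z \<longleftrightarrow>
     Z \<in> borel_measurable M \<and> (\<forall>X\<in>\<Phi>. AE \<omega> in M. X \<omega> \<le> Z \<omega>) \<and>
     (\<forall>W\<in>borel_measurable M. (\<forall>X\<in>\<Phi>. AE \<omega> in M. X \<omega> \<le> W \<omega>) \<longrightarrow> (AE \<omega> in M. Z \<omega> \<le> W \<omega>))"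

text \<open>An arbitrary version; see \<open>is_ess_sup_ess_sup\<close> and \<open>is_ess_sup_AE_unique\<close> below.\<close>

definition ess_sup :: "'a measure \<Rightarrow> ('a \<Rightarrow> ennreal) set \<Rightarrow> 'a \<Rightarrow> ennreal" where
  "ess_sup M \<Phi> = (SOME Z. is_ess_sup M \<Phi> Z)"

lemma is_ess_sup_AE_unique:
  assumes "is_ess_sup M \<Phi> Z" "is_ess_sup M \<Phi> Z'"
  shows "AE \<omega> in M. Z \<omega> = Z' \<omega>"
proof -
  have "AE \<omega> in M. Z \<omega> \<le> Z' \<omega>" "AE \<omega> in M. Z' \<omega> \<le> Z \<omega>"
    using assms by (auto simp: is_ess_sup_def)
  then show ?thesis by eventually_elim (rule antisym)
qed

lemma (in finite_measure) is_ess_sup_exists: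
  assumes \<Phi>: "\<Phi> \<subseteq> borel_measurable M"
  shows "\<exists>Z. is_ess_sup M \<Phi> Z"
proof -
  define S where "S C \<omega> = (SUP X\<in>C. X \<omega>)" for C :: "('a \<Rightarrow> ennreal) set" and \<omega>
  define J where "J C = (\<integral>\<^sup>+\<omega>. inverse (1 + S C \<omega>) \<partial>M)" for C
  define \<C> where "\<C> = {C. countable C \<and> C \<subseteq> \<Phi>}"
  have meas: "S C \<in> borel_measurable M" if "C \<in> \<C>" for C
    unfolding S_def using that \<Phi> by (intro borel_measurable_SUP) (auto simp: \<C>_def)
  have S_mono: "S C \<omega> \<le> S D \<omega>" if "C \<subseteq> D" for C D \<omega>
    unfolding S_def by (rule SUP_subset_mono[OF that order_refl])
  have anti: "inverse (1 + b) \<le> inverse (1 + a)" if "a \<le> b" for a b :: ennreal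
    using that by (cases a; cases b)
      (auto simp: inverse_ennreal ennreal_plus[symmetric] ennreal_1[symmetric] top_unique
        intro!: ennreal_leI simp del: ennreal_plus ennreal_1)
  have J_anti: "J D \<le> J C" if "C \<subseteq> D" for C D
    unfolding J_def by (intro nn_integral_mono anti S_mono that)
  have "{} \<in> \<C>" by (auto simp: \<C>_def)
  then obtain f where f: "range f \<subseteq> J ` \<C>" "f \<longlonglongrightarrow> Inf (J ` \<C>)"
    using Inf_as_limit[of "J ` \<C>"] by blast
  then have "\<forall>n. \<exists>C\<in>\<C>. f n = J C" by auto
  then obtain C where C: "\<And>n. C n \<in> \<C>" "\<And>n. f n = J (C n)" by metis
  define D where "D = (\<Union>n. C n)"
  have D: "D \<in> \<C>" using C(1) by (auto simp: D_def \<C>_def)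
  have "J D \<le> f n" for n unfolding C(2) by (rule J_anti) (auto simp: D_def)
  then have "J D \<le> Inf (J ` \<C>)"
    using f(2) by (intro LIMSEQ_le_const) auto
  then have min: "J D \<le> J E" if "E \<in> \<C>" for E
    using that by (meson INF_lower order_trans)
  have "AE \<omega> in M. X \<omega> \<le> S D \<omega>" if X: "X \<in> \<Phi>" for X
  proof -
    have E: "insert X D \<in> \<C>" using D X by (auto simp: \<C>_def)
    note [measurable] = meas[OF D] meas[OF E]
    let ?a = "\<lambda>\<omega>. inverse (1 + S (insert X D) \<omega>)" and ?b = "\<lambda>\<omega>. inverse (1 + S D \<omega>)"
    have le1: "inverse (1 + x) \<le> 1" for x :: ennreal
      using anti[of 0 x] by simp
    have "(\<integral>\<^sup>+\<omega>. ?a \<omega> \<partial>M) \<le> (\<integral>\<^sup>+\<omega>. 1 \<partial>M)"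
      by (intro nn_integral_mono le1)
    also have "\<dots> < \<infinity>" by (simp add: emeasure_eq_ennreal_measure)
    finally have fin: "(\<integral>\<^sup>+\<omega>. ?a \<omega> \<partial>M) \<noteq> \<infinity>" by auto
    have "AE \<omega> in M. ?b \<omega> \<le> ?a \<omega>"
    proof (rule ccontr)
      assume *: "\<not> (AE \<omega> in M. ?b \<omega> \<le> ?a \<omega>)"
      have "(\<integral>\<^sup>+\<omega>. ?a \<omega> \<partial>M) < (\<integral>\<^sup>+\<omega>. ?b \<omega> \<partial>M)"
        by (rule nn_integral_less[OF _ _ fin _ *])
           (auto intro!: AE_I2 anti S_mono)
      then show False using min[OF E] by (simp add: J_def)
    qed
    then show ?thesis
    proof eventually_elim
      case (elim \<omega>)
      have "1 + S (insert X D) \<omega> \<le> 1 + S D \<omega>"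
      proof (rule ccontr)
        assume "\<not> 1 + S (insert X D) \<omega> \<le> 1 + S D \<omega>"
        then have "inverse (1 + S (insert X D) \<omega>) < inverse (1 + S D \<omega>)"
          by (cases "S D \<omega>"; cases "S (insert X D) \<omega>")
             (auto simp: not_le inverse_ennreal ennreal_plus[symmetric] ennreal_less_iff
               ennreal_1[symmetric] simp del: ennreal_plus ennreal_1)
        with elim show False by simp
      qed
      then have "S (insert X D) \<omega> \<le> S D \<omega>"
        by (simp add: ennreal_add_left_cancel_le)
      moreover have "X \<omega> \<le> S (insert X D) \<omega>" unfolding S_def by (rule SUP_upper) simp
      ultimately show ?case by order
    qed
  qed
  moreover have "AE \<omega> in M. S D \<omega> \<le> W \<omega>" if "\<forall>X\<in>\<Phi>. AE \<omega> in M. X \<omega> \<le> W \<omega>" for W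
  proof -
    have "AE \<omega> in M. \<forall>X\<in>D. X \<omega> \<le> W \<omega>"
      using D that by (subst AE_ball_countable) (auto simp: \<C>_def)
    then show ?thesis by eventually_elim (auto simp: S_def intro: SUP_least)
  qed
  ultimately show ?thesis using meas[OF D] unfolding is_ess_sup_def by blast
qed

lemma (in finite_measure) is_ess_sup_ess_sup:
  "\<Phi> \<subseteq> borel_measurable M \<Longrightarrow> is_ess_sup M \<Phi> (ess_sup M \<Phi>)"
  unfolding ess_sup_def by (rule someI_ex[OF is_ess_sup_exists])

section \<open>Reward process and values\<close>

text \<open>
  \<open>Y t \<omega>\<close> is only relevant for \<open>t \<ge> 0\<close>.  The reward is extended to \<open>\<infinity>\<close> by the limit superior,
  which may be infinite on a null set; since all rewards are nonnegative, they are considered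
  as \<^typ>\<open>ennreal\<close>-valued and conditional expectations are taken by \<^const>\<open>nn_cond_exp\<close>.
\<close>

locale reward_process = usual_filtered_prob_space M F
  for M :: "'a measure" and F :: "ennreal \<Rightarrow> 'a measure" +
  fixes Y :: "real \<Rightarrow> 'a \<Rightarrow> real"
  assumes adapted: "\<And>t. 0 \<le> t \<Longrightarrow> Y t \<in> borel_measurable (F (ennreal t))"
    and nonneg: "\<And>t \<omega>. 0 \<le> t \<Longrightarrow> \<omega> \<in> space M \<Longrightarrow> 0 \<le> Y t \<omega>"
    and right_continuous:
      "\<And>t \<omega>. 0 \<le> t \<Longrightarrow> \<omega> \<in> space M \<Longrightarrow> continuous (at_right t) (\<lambda>s. Y s \<omega>)"
    and sup_integrable: "(\<integral>\<^sup>+\<omega>. (SUP t\<in>{0..}. ennreal (Y t \<omega>)) \<partial>M) < \<infinity>"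

definition reward :: "(real \<Rightarrow> 'a \<Rightarrow> real) \<Rightarrow> ennreal \<Rightarrow> 'a \<Rightarrow> ennreal" where
  "reward Y t \<omega> =
     (if t < \<infinity> then ennreal (Y (enn2real t) \<omega>) else Limsup at_top (\<lambda>s. ennreal (Y s \<omega>)))"

abbreviation stopped_sigma ::
  "'a measure \<Rightarrow> (ennreal \<Rightarrow> 'a measure) \<Rightarrow> ('a \<Rightarrow> ennreal) \<Rightarrow> 'a measure" where
  "stopped_sigma M A \<sigma> \<equiv> filtration.pre_sigma (space M) A \<sigma>"

definition total_reward :: "(real \<Rightarrow> 'a \<Rightarrow> real) \<Rightarrow> ('a \<Rightarrow> ennreal) list \<Rightarrow> 'a \<Rightarrow> ennreal" where
  "total_reward Y \<tau> \<omega> = (\<Sum>i<length \<tau>. reward Y ((\<tau> ! i) \<omega>) \<omega>)"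

definition val ::
  "'a measure \<Rightarrow> (real \<Rightarrow> 'a \<Rightarrow> real) \<Rightarrow> nat \<Rightarrow> ('a \<Rightarrow> ennreal) list \<Rightarrow> (ennreal \<Rightarrow> 'a measure)
    \<Rightarrow> ('a \<Rightarrow> ennreal) \<Rightarrow> 'a \<Rightarrow> ennreal" where
  "val M Y m \<gamma> A \<sigma> =
     (if m = 0 then (\<lambda>\<omega>. 0)
      else ess_sup M {nn_cond_exp M (stopped_sigma M A \<sigma>) (total_reward Y \<tau>) | \<tau>.
             \<tau> \<in> strategies (space M) m \<gamma> A \<sigma>})"

definition val_disc ::
  "'a measure \<Rightarrow> (real \<Rightarrow> 'a \<Rightarrow> real) \<Rightarrow> nat \<Rightarrow> ('a \<Rightarrow> ennreal) list \<Rightarrow> (ennreal \<Rightarrow> 'a measure)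
    \<Rightarrow> ('a \<Rightarrow> ennreal) \<Rightarrow> 'a \<Rightarrow> ennreal" where
  "val_disc M Y m \<gamma> A \<sigma> =
     (if m = 0 then (\<lambda>\<omega>. 0)
      else ess_sup M {nn_cond_exp M (stopped_sigma M A \<sigma>) (total_reward Y \<tau>) | \<tau>.
             \<tau> \<in> strategies_disc (space M) m \<gamma> A \<sigma>})"

end

theory Submission
  imports Defs
begin

text \<open>
  A strategy for \<open>n\<close> stops is a first stopping time \<open>\<tau>\<close> followed by a strategy for \<open>n - 1\<close> stops that
  starts from \<open>\<rho> = \<tau> + \<delta>\<^sub>1\<close> in the enlarged filtration \<open>G\<close>.  Since the sigma-algebra of \<open>\<sigma>\<close> is contained
  in that of \<open>\<tau>\<close>, and the latter in that of \<open>\<rho>\<close> with respect to \<open>G\<close>, the tower property gives \<open>\<le>\<close>.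
  For \<open>\<ge>\<close> the essential supremum defining the continuation value has to be exchanged with the
  conditional expectation.  This is monotone convergence once the family is known to be directed:
  two strategies can be pasted along the \<open>G\<^sub>\<rho>\<close>-measurable event where the first one is at least as
  good, and the pasted tuple is again a strategy because on this event the pasted filtrations
  have the same trace after \<open>\<rho>\<close> as those of the first strategy (and likewise on the complement).
\<close>

section \<open>Essential suprema and conditional expectations\<close>

text \<open>An essential supremum is determined by its measurable almost sure upper bounds. Both
  claims of the theorem are thereby reduced to comparing upper bounds \<open>W\<close>, with no
  nested essential suprema over first stops and continuations.\<close>

lemma (in finite_measure) ess_sup_AE_eqI:
  assumes "\<Phi> \<subseteq> borel_measurable M" "\<Psi> \<subseteq> borel_measurable M"
    and "\<And>W. W \<in> borel_measurable M \<Longrightarrow>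
      (\<forall>X\<in>\<Phi>. AE \<omega> in M. X \<omega> \<le> W \<omega>) \<longleftrightarrow> (\<forall>X\<in>\<Psi>. AE \<omega> in M. X \<omega> \<le> W \<omega>)"
  shows "AE \<omega> in M. ess_sup M \<Phi> \<omega> = ess_sup M \<Psi> \<omega>"
proof (rule is_ess_sup_AE_unique)
  show "is_ess_sup M \<Phi> (ess_sup M \<Phi>)" by (rule is_ess_sup_ess_sup[OF assms(1)])
  show "is_ess_sup M \<Phi> (ess_sup M \<Psi>)"
    using is_ess_sup_ess_sup[OF assms(2)] assms(3) by (auto simp: is_ess_sup_def)
qed

text \<open>Take members whose integrals approach the supremum \<open>s\<close> of all integrals,
  and use directedness to replace them by an increasing sequence. Its limit \<open>S\<close> has
  integral \<open>s\<close>, so no member can exceed \<open>S\<close> on a non-null set without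
  pushing some integral of the family above \<open>s\<close>.\<close>

lemma (in finite_measure) ess_sup_directed:
  assumes ne: "\<Phi> \<noteq> {}" and meas: "\<Phi> \<subseteq> borel_measurable M"
    and directed: "\<And>X Y. X \<in> \<Phi> \<Longrightarrow> Y \<in> \<Phi> \<Longrightarrow> \<exists>Z\<in>\<Phi>. AE \<omega> in M. max (X \<omega>) (Y \<omega>) \<le> Z \<omega>"
    and bound: "\<And>X. X \<in> \<Phi> \<Longrightarrow> (\<integral>\<^sup>+\<omega>. X \<omega> \<partial>M) \<le> c" "c < \<infinity>"
  obtains X :: "nat \<Rightarrow> 'a \<Rightarrow> ennreal" where "\<And>i. X i \<in> \<Phi>"
    and "\<And>i. AE \<omega> in M. X i \<omega> \<le> X (Suc i) \<omega>"
    and "AE \<omega> in M. ess_sup M \<Phi> \<omega> = (SUP i. X i \<omega>)"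
proof -
  define s where "s = (SUP X\<in>\<Phi>. \<integral>\<^sup>+\<omega>. X \<omega> \<partial>M)"
  obtain f :: "nat \<Rightarrow> ennreal" where f: "range f \<subseteq> (\<lambda>X. \<integral>\<^sup>+\<omega>. X \<omega> \<partial>M) ` \<Phi>" "s = (SUP i. f i)"
    using ennreal_SUP_countable_SUP[OF ne, of "\<lambda>X. \<integral>\<^sup>+\<omega>. X \<omega> \<partial>M"] unfolding s_def by auto
  then have "\<forall>i. \<exists>X\<in>\<Phi>. f i = (\<integral>\<^sup>+\<omega>. X \<omega> \<partial>M)" by auto
  then obtain U where U: "\<And>i. U i \<in> \<Phi>" "\<And>i. f i = (\<integral>\<^sup>+\<omega>. U i \<omega> \<partial>M)" by metis
  obtain J where J: "\<And>X Y. X \<in> \<Phi> \<Longrightarrow> Y \<in> \<Phi> \<Longrightarrow> J X Y \<in> \<Phi>"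
      "\<And>X Y. X \<in> \<Phi> \<Longrightarrow> Y \<in> \<Phi> \<Longrightarrow> AE \<omega> in M. max (X \<omega>) (Y \<omega>) \<le> J X Y \<omega>"
    using directed by metis
  \<comment> \<open>Joining with \<open>U (Suc i)\<close> at each step makes the sequence increasing
    and keeps it above \<open>U\<close>, so its integrals reach \<open>s\<close> as well.\<close>
  define X where "X = rec_nat (U 0) (\<lambda>i x. J x (U (Suc i)))"
  have X: "X i \<in> \<Phi>" for i by (induction i) (auto simp: X_def U J)
  have step: "AE \<omega> in M. max (X i \<omega>) (U (Suc i) \<omega>) \<le> X (Suc i) \<omega>" for i
    using J(2)[OF X[of i] U(1)[of "Suc i"]] by (simp add: X_def)
  have inc: "AE \<omega> in M. X i \<omega> \<le> X (Suc i) \<omega>" for i using step[of i] by eventually_elim simp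
  have UX: "AE \<omega> in M. U i \<omega> \<le> X i \<omega>" for i
  proof (cases i)
    case (Suc j) then show ?thesis using step[of j] by simp
  qed (simp add: X_def)
  have [measurable]: "X i \<in> borel_measurable M" for i using X meas by auto
  define S where "S \<omega> = (SUP i. X i \<omega>)" for \<omega>
  have [measurable]: "S \<in> borel_measurable M" unfolding S_def by measurable
  have int_S: "(\<integral>\<^sup>+\<omega>. S \<omega> \<partial>M) = s"
  proof -
    have "(\<integral>\<^sup>+\<omega>. S \<omega> \<partial>M) = (SUP i. \<integral>\<^sup>+\<omega>. X i \<omega> \<partial>M)"
      unfolding S_def by (rule nn_integral_monotone_convergence_SUP_AE) (auto intro: inc)
    moreover have "\<dots> \<le> s" unfolding s_def by (intro SUP_least SUP_upper X)
    moreover have "s \<le> (SUP i. \<integral>\<^sup>+\<omega>. X i \<omega> \<partial>M)"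
      unfolding f(2) U(2) by (intro SUP_mono' nn_integral_mono_AE UX)
    ultimately show ?thesis by simp
  qed
  have "s < \<infinity>" using bound by (auto simp: s_def intro: order.strict_trans1[OF SUP_least])
  have upper: "AE \<omega> in M. V \<omega> \<le> S \<omega>" if V: "V \<in> \<Phi>" for V
  proof -
    have [measurable]: "V \<in> borel_measurable M" using V meas by auto
    \<comment> \<open>\<open>max V S\<close> is the limit of \<open>max V (X i)\<close>, each of
      which lies below a member of \<open>\<Phi>\<close>; hence its integral is at most
      \<open>s\<close>. Finiteness of \<open>s\<close> then turns equality of integrals into almost
      sure equality.\<close>
    have "(\<integral>\<^sup>+\<omega>. max (V \<omega>) (S \<omega>) \<partial>M) = (\<integral>\<^sup>+\<omega>. (SUP i. max (V \<omega>) (X i \<omega>)) \<partial>M)"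
      by (simp add: S_def sup_max[symmetric] SUP_sup_distrib[symmetric])
    also have "\<dots> = (SUP i. \<integral>\<^sup>+\<omega>. max (V \<omega>) (X i \<omega>) \<partial>M)"
    proof (rule nn_integral_monotone_convergence_SUP_AE)
      show "AE \<omega> in M. max (V \<omega>) (X i \<omega>) \<le> max (V \<omega>) (X (Suc i) \<omega>)" for i
        using inc[of i] by eventually_elim (auto simp: max_def)
    qed simp
    also have "\<dots> \<le> s"
    proof (rule SUP_least)
      fix i
      have "(\<integral>\<^sup>+\<omega>. max (V \<omega>) (X i \<omega>) \<partial>M) \<le> (\<integral>\<^sup>+\<omega>. J V (X i) \<omega> \<partial>M)"
        by (rule nn_integral_mono_AE[OF J(2)[OF V X]])
      also have "\<dots> \<le> s" unfolding s_def by (intro SUP_upper J V X)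
      finally show "(\<integral>\<^sup>+\<omega>. max (V \<omega>) (X i \<omega>) \<partial>M) \<le> s" .
    qed
    finally have le: "(\<integral>\<^sup>+\<omega>. max (V \<omega>) (S \<omega>) \<partial>M) \<le> (\<integral>\<^sup>+\<omega>. S \<omega> \<partial>M)" by (simp add: int_S)
    have "AE \<omega> in M. max (V \<omega>) (S \<omega>) \<le> S \<omega>"
    proof (rule ccontr)
      assume "\<not> (AE \<omega> in M. max (V \<omega>) (S \<omega>) \<le> S \<omega>)"
      then have "(\<integral>\<^sup>+\<omega>. S \<omega> \<partial>M) < (\<integral>\<^sup>+\<omega>. max (V \<omega>) (S \<omega>) \<partial>M)"
        using \<open>s < \<infinity>\<close> by (intro nn_integral_less) (auto simp: int_S)
      with le show False by simp
    qed
    then show ?thesis by eventually_elim simp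
  qed
  have "is_ess_sup M \<Phi> S"
    unfolding is_ess_sup_def
  proof (intro conjI ballI impI upper)
    fix W assume "\<forall>X\<in>\<Phi>. AE \<omega> in M. X \<omega> \<le> W \<omega>"
    then have "AE \<omega> in M. \<forall>i. X i \<omega> \<le> W \<omega>" using X by (subst AE_all_countable) auto
    then show "AE \<omega> in M. S \<omega> \<le> W \<omega>" by eventually_elim (auto simp: S_def intro: SUP_least)
  qed simp_all
  then have "AE \<omega> in M. ess_sup M \<Phi> \<omega> = (SUP i. X i \<omega>)"
    unfolding S_def[symmetric] by (rule is_ess_sup_AE_unique[OF is_ess_sup_ess_sup[OF meas]])
  with X inc show thesis by (rule that)
qed

section \<open>Rules for conditional expectations of non-negative functions\<close>

context sigma_finite_subalgebra
begin

lemma nn_integral_nn_cond_exp: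
  assumes [measurable]: "f \<in> borel_measurable M"
  shows "(\<integral>\<^sup>+x. nn_cond_exp M F f x \<partial>M) = (\<integral>\<^sup>+x. f x \<partial>M)"
  using nn_cond_exp_intg[of "\<lambda>_. 1" f] by simp

text \<open>Monotone convergence is applied twice on each set of \<open>F\<close>, to the functions
  and to their conditional expectations. Monotonicity is only asked almost everywhere because that
  is what \<open>ess_sup_directed\<close> supplies.\<close>

lemma nn_cond_exp_SUP:
  fixes f :: "nat \<Rightarrow> 'a \<Rightarrow> ennreal"
  assumes [measurable]: "\<And>i. f i \<in> borel_measurable M"
    and inc: "\<And>i. AE x in M. f i x \<le> f (Suc i) x"
  shows "AE x in M. nn_cond_exp M F (\<lambda>x. SUP i. f i x) x = (SUP i. nn_cond_exp M F (f i) x)"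
proof -
  have "AE x in M. (SUP i. nn_cond_exp M F (f i) x) = nn_cond_exp M F (\<lambda>x. SUP i. f i x) x"
  proof (rule nn_cond_exp_charact)
    fix B assume B[measurable]: "B \<in> sets F"
    then have [measurable]: "B \<in> sets M" using subalg by (auto simp: subalgebra_def)
    have ind_inc: "AE x in M. g i x * indicator B x \<le> g (Suc i) x * indicator B x"
      if "AE x in M. g i x \<le> g (Suc i) x" for g :: "nat \<Rightarrow> 'a \<Rightarrow> ennreal" and i
      using that by eventually_elim (auto intro: mult_right_mono)
    have "(\<integral>\<^sup>+x\<in>B. (SUP i. f i x) \<partial>M) = (\<integral>\<^sup>+x. (SUP i. f i x * indicator B x) \<partial>M)"
      by (simp add: SUP_mult_right_ennreal)
    also have "\<dots> = (SUP i. \<integral>\<^sup>+x\<in>B. f i x \<partial>M)"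
      by (rule nn_integral_monotone_convergence_SUP_AE) (simp_all add: ind_inc inc)
    also have "\<dots> = (SUP i. \<integral>\<^sup>+x\<in>B. nn_cond_exp M F (f i) x \<partial>M)"
      using nn_cond_exp_intg[of "indicator B"] by (simp add: mult.commute)
    also have "\<dots> = (\<integral>\<^sup>+x. (SUP i. nn_cond_exp M F (f i) x * indicator B x) \<partial>M)"
      by (rule nn_integral_monotone_convergence_SUP_AE[symmetric])
         (auto intro!: ind_inc[of "\<lambda>i. nn_cond_exp M F (f i)"] nn_cond_exp_mono inc)
    also have "\<dots> = (\<integral>\<^sup>+x\<in>B. (SUP i. nn_cond_exp M F (f i) x) \<partial>M)"
      by (simp add: SUP_mult_right_ennreal)
    finally show "(\<integral>\<^sup>+x\<in>B. (SUP i. f i x) \<partial>M) = (\<integral>\<^sup>+x\<in>B. (SUP i. nn_cond_exp M F (f i) x) \<partial>M)" .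
  qed simp_all
  then show ?thesis by eventually_elim simp
qed

text \<open>The tower property applied to the second summand only. It is used twice: to drop the
  conditioning at the first stop, and to insert the conditioning at the start of the
  continuation.\<close>

lemma nn_cond_exp_add_nested:
  assumes "subalgebra M G" "subalgebra G F"
    and [measurable]: "r \<in> borel_measurable M" "f \<in> borel_measurable M"
  shows "AE x in M. nn_cond_exp M F (\<lambda>x. r x + nn_cond_exp M G f x) x
    = nn_cond_exp M F (\<lambda>x. r x + f x) x"
proof -
  have "AE x in M. nn_cond_exp M F r x + nn_cond_exp M F (nn_cond_exp M G f) x
      = nn_cond_exp M F (\<lambda>x. r x + nn_cond_exp M G f x) x"
    "AE x in M. nn_cond_exp M F r x + nn_cond_exp M F f x = nn_cond_exp M F (\<lambda>x. r x + f x) x"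
    by (intro nn_cond_exp_sum; simp)+
  with nn_cond_exp_nested_subalg[OF assms(1,2,4)] show ?thesis
    by eventually_elim simp
qed

text \<open>The indicators of \<open>C\<close> and of its complement are \<open>F\<close>-measurable
  and can be pulled out. This computes the conditional reward of a pasted strategy.\<close>

lemma nn_cond_exp_if:
  assumes C: "C \<in> sets F" and [measurable]: "f \<in> borel_measurable M" "g \<in> borel_measurable M"
  shows "AE x in M. nn_cond_exp M F (\<lambda>x. if x \<in> C then f x else g x) x
    = (if x \<in> C then nn_cond_exp M F f x else nn_cond_exp M F g x)"
proof -
  have sp: "space F = space M" using subalg by (simp add: subalgebra_def)
  have [measurable]: "C \<in> sets F" "C \<in> sets M" "space M - C \<in> sets F" "space M - C \<in> sets M"
    using C subalg sets.compl_sets[OF C] by (auto simp: subalgebra_def)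
  let ?i = "\<lambda>x. indicator C x * f x" and ?j = "\<lambda>x. indicator (space M - C) x * g x"
  have "AE x in M. nn_cond_exp M F (\<lambda>x. if x \<in> C then f x else g x) x
      = nn_cond_exp M F (\<lambda>x. ?i x + ?j x) x"
    by (rule nn_cond_exp_cong) (auto intro!: AE_I2 measurable_If_set simp: indicator_def)
  moreover have "AE x in M. nn_cond_exp M F ?i x + nn_cond_exp M F ?j x
      = nn_cond_exp M F (\<lambda>x. ?i x + ?j x) x"
    by (rule nn_cond_exp_sum) simp_all
  moreover have "AE x in M. indicator C x * nn_cond_exp M F f x = nn_cond_exp M F ?i x"
    "AE x in M. indicator (space M - C) x * nn_cond_exp M F g x = nn_cond_exp M F ?j x"
    by (rule nn_cond_exp_prod; simp)+
  ultimately show ?thesis using AE_space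
    by eventually_elim (auto simp: indicator_def split: if_splits)
qed

end

section \<open>Measurability of rewards\<close>

text \<open>Approximate \<open>T\<close> from the right by grid points of mesh
  \<open>1 / Suc k\<close>. Each approximation takes countably many values, so sampling
  \<open>Y\<close> there is measurable, and right-continuity gives convergence.\<close>

lemma borel_measurable_right_continuous_process:
  fixes Y :: "real \<Rightarrow> 'a \<Rightarrow> real"
  assumes Y: "\<And>t. 0 \<le> t \<Longrightarrow> Y t \<in> borel_measurable M"
    and rc: "\<And>t \<omega>. 0 \<le> t \<Longrightarrow> \<omega> \<in> space M \<Longrightarrow> continuous (at_right t) (\<lambda>s. Y s \<omega>)"
    and [measurable]: "T \<in> borel_measurable M" and T0: "\<And>\<omega>. 0 \<le> T \<omega>"
  shows "(\<lambda>\<omega>. Y (T \<omega>) \<omega>) \<in> borel_measurable M"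
proof -
  \<comment> \<open>The \<open>+ 1\<close> in the numerator puts the grid point strictly to the
    right of \<open>T\<close>, as a limit along \<open>at_right\<close> requires.\<close>
  define q where "q k i = (real i + 1) / real (Suc k)" for k i :: nat
  define g where "g k \<omega> = nat \<lfloor>T \<omega> * real (Suc k)\<rfloor>" for k \<omega>
  have [measurable]: "g k \<in> M \<rightarrow>\<^sub>M count_space UNIV" for k unfolding g_def by measurable
  have meas: "(\<lambda>\<omega>. Y (q k (g k \<omega>)) \<omega>) \<in> borel_measurable M" for k
    by (rule measurable_compose_countable[of "\<lambda>i. Y (q k i)"]) (auto intro!: Y simp: q_def)
  have bounds: "T \<omega> < q k (g k \<omega>) \<and> q k (g k \<omega>) \<le> T \<omega> + 1 / real (Suc k)" for k \<omega>
  proof -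
    have "0 \<le> T \<omega> * real (Suc k)" using T0 by simp
    then have "T \<omega> * real (Suc k) < real (g k \<omega>) + 1" "real (g k \<omega>) \<le> T \<omega> * real (Suc k)"
      unfolding g_def by linarith+
    then show ?thesis unfolding q_def
      by (simp add: pos_less_divide_eq pos_divide_le_eq distrib_right)
  qed
  have lim: "(\<lambda>k. q k (g k \<omega>)) \<longlonglongrightarrow> T \<omega>" for \<omega>
  proof (rule tendsto_sandwich)
    show "\<forall>\<^sub>F k in sequentially. T \<omega> \<le> q k (g k \<omega>)"
      using bounds by (auto intro: always_eventually less_imp_le)
    show "\<forall>\<^sub>F k in sequentially. q k (g k \<omega>) \<le> T \<omega> + 1 / real (Suc k)"
      using bounds by (auto intro: always_eventually)
    show "(\<lambda>k. T \<omega> + 1 / real (Suc k)) \<longlonglongrightarrow> T \<omega>"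
      using tendsto_add[OF tendsto_const LIMSEQ_inverse_real_of_nat, of "T \<omega>"]
      by (simp add: inverse_eq_divide)
  qed simp
  have "filterlim (\<lambda>k. q k (g k \<omega>)) (at_right (T \<omega>)) sequentially" for \<omega>
    using bounds lim by (auto simp: filterlim_at intro!: always_eventually less_imp_neq[symmetric])
  then have "(\<lambda>k. Y (q k (g k \<omega>)) \<omega>) \<longlonglongrightarrow> Y (T \<omega>) \<omega>" if "\<omega> \<in> space M" for \<omega>
    using rc[OF T0 that, of \<omega>] unfolding continuous_within by (rule filterlim_compose[rotated])
  with meas show ?thesis by (rule borel_measurable_LIMSEQ_metric)
qed

text \<open>If \<open>f\<close> exceeded the rational supremum at some \<open>s\<close>, it would do
  so on an interval to the right of \<open>s\<close>, which contains a rational. The countable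
  formula makes the reward at infinity measurable.\<close>

lemma Limsup_at_top_right_continuous:
  fixes f :: "real \<Rightarrow> ennreal"
  assumes rc: "\<And>t. 0 \<le> t \<Longrightarrow> continuous (at_right t) f"
  shows "Limsup at_top f = (INF n::nat. SUP q\<in>\<rat> \<inter> {real n..}. f q)"
proof (rule antisym)
  show "Limsup at_top f \<le> (INF n::nat. SUP q\<in>\<rat> \<inter> {real n..}. f q)"
  proof (rule INF_greatest)
    fix n :: nat
    let ?c = "SUP q\<in>\<rat> \<inter> {real n..}. f q"
    have "f s \<le> ?c" if s: "s \<ge> real n" for s
    proof (rule ccontr)
      assume "\<not> f s \<le> ?c"
      then have "\<forall>\<^sub>F u in at_right s. ?c < f u"
        using rc[of s] s by (intro order_tendstoD(1)[of f "f s"]) (auto simp: continuous_within)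
      then obtain b where b: "b > s" "\<And>u. s < u \<Longrightarrow> u < b \<Longrightarrow> ?c < f u"
        by (auto simp: eventually_at_right_field)
      obtain q where q: "q \<in> \<rat>" "s < q" "q < b" using Rats_dense_in_real[OF b(1)] by blast
      then have "f q \<le> ?c" using s by (intro SUP_upper) auto
      with b(2)[OF q(2,3)] show False by simp
    qed
    then show "Limsup at_top f \<le> ?c"
      by (intro Limsup_bounded) (auto simp: eventually_at_top_linorder)
  qed
  show "(INF n::nat. SUP q\<in>\<rat> \<inter> {real n..}. f q) \<le> Limsup at_top f"
    unfolding Limsup_def
  proof (rule INF_greatest)
    fix P :: "real \<Rightarrow> bool" assume "P \<in> {P. eventually P at_top}"
    then obtain N where N: "\<And>s. s \<ge> N \<Longrightarrow> P s" by (auto simp: eventually_at_top_linorder)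
    obtain n :: nat where "N \<le> real n" using real_arch_simple by blast
    with N have "(SUP q\<in>\<rat> \<inter> {real n..}. f q) \<le> (SUP x\<in>{x. P x}. f x)"
      by (intro SUP_subset_mono) auto
    then show "(INF n::nat. SUP q\<in>\<rat> \<inter> {real n..}. f q) \<le> (SUP x\<in>{x. P x}. f x)"
      by (rule INF_lower2[OF UNIV_I])
  qed
qed

section \<open>Measurability and integrability of the rewards\<close>

context reward_process
begin

lemma borel_measurable_reward:
  assumes [measurable]: "T \<in> borel_measurable M"
  shows "(\<lambda>\<omega>. reward Y (T \<omega>) \<omega>) \<in> borel_measurable M"
proof -
  have Y[measurable]: "Y t \<in> borel_measurable M" if "0 \<le> t" for t
    using adapted[OF that] sets_F_subset[of "ennreal t"]
    by (auto simp: space_F intro: measurable_from_subalg[rotated] simp: subalgebra_def)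
  have rc: "continuous (at_right t) (\<lambda>s. ennreal (Y s \<omega>))" if "0 \<le> t" "\<omega> \<in> space M" for t \<omega>
    using right_continuous[OF that] unfolding continuous_within by (rule tendsto_ennrealI)
  have "(\<lambda>\<omega>. INF n::nat. SUP q\<in>\<rat> \<inter> {real n..}. ennreal (Y q \<omega>)) \<in> borel_measurable M"
  proof (intro borel_measurable_INF borel_measurable_SUP)
    show "countable (\<rat> \<inter> {real n..})" for n by (rule countable_Int1[OF countable_rat])
    show "(\<lambda>\<omega>. ennreal (Y q \<omega>)) \<in> borel_measurable M" if "q \<in> \<rat> \<inter> {real n..}" for n q
      using that Y[of q] by simp
  qed simp
  then have [measurable]: "(\<lambda>\<omega>. Limsup at_top (\<lambda>s. ennreal (Y s \<omega>))) \<in> borel_measurable M"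
    by (subst measurable_cong[OF Limsup_at_top_right_continuous]) (auto intro: rc)
  have [measurable]: "(\<lambda>\<omega>. Y (enn2real (T \<omega>)) \<omega>) \<in> borel_measurable M"
    by (rule borel_measurable_right_continuous_process) (auto intro: Y right_continuous)
  show ?thesis unfolding reward_def by measurable
qed

lemma reward_le_SUP: "reward Y t \<omega> \<le> (SUP t\<in>{0..}. ennreal (Y t \<omega>))"
  unfolding reward_def
  by (auto intro!: SUP_upper Limsup_bounded eventually_at_top_linorderI[of 0])

text \<open>The bound depends on the strategy only through its number of stops, so it serves as the
  constant \<open>c\<close> in \<open>ess_sup_directed\<close>.\<close>

lemma nn_integral_total_reward_le:
  assumes "set \<tau> \<subseteq> borel_measurable M"
  shows "(\<integral>\<^sup>+\<omega>. total_reward Y \<tau> \<omega> \<partial>M) \<le> of_nat (length \<tau>) * (\<integral>\<^sup>+\<omega>. (SUP t\<in>{0..}. ennreal (Y t \<omega>)) \<partial>M)"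
proof -
  have "(\<lambda>\<omega>. reward Y ((\<tau> ! i) \<omega>) \<omega>) \<in> borel_measurable M" if "i < length \<tau>" for i
    using that assms by (intro borel_measurable_reward) auto
  then have "(\<integral>\<^sup>+\<omega>. total_reward Y \<tau> \<omega> \<partial>M) = (\<Sum>i<length \<tau>. \<integral>\<^sup>+\<omega>. reward Y ((\<tau> ! i) \<omega>) \<omega> \<partial>M)"
    unfolding total_reward_def by (intro nn_integral_sum) simp
  also have "\<dots> \<le> (\<Sum>i<length \<tau>. \<integral>\<^sup>+\<omega>. (SUP t\<in>{0..}. ennreal (Y t \<omega>)) \<partial>M)"
    by (intro sum_mono nn_integral_mono reward_le_SUP)
  finally show ?thesis by simp
qed

lemma borel_measurable_total_reward:
  assumes "set \<tau> \<subseteq> borel_measurable M"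
  shows "total_reward Y \<tau> \<in> borel_measurable M"
proof -
  have "(\<lambda>\<omega>. reward Y ((\<tau> ! i) \<omega>) \<omega>) \<in> borel_measurable M" if "i < length \<tau>" for i
    using that assms by (intro borel_measurable_reward) auto
  then show ?thesis unfolding total_reward_def[abs_def] by (intro borel_measurable_sum) simp
qed

end

section \<open>Filtrations and strategies\<close>

text \<open>Enlargement by a measurable time preserves these properties, so inductions over the
  number of stops can move from a filtration to its successive enlargements.\<close>

locale subfiltration = filtration "space M" A for M :: "'a measure" and A :: "ennreal \<Rightarrow> 'a measure" +
  assumes sets_A_subset: "\<And>t. sets (A t) \<subseteq> sets M"
    and sets_A_infinity: "sets (A \<infinity>) = sigma_sets (space M) (\<Union>t\<in>{..<\<infinity>}. sets (A t))"
begin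

lemma borel_measurable_stopping_time: "stopping_time A T \<Longrightarrow> T \<in> borel_measurable M"
  by (rule measurable_stopping_time[of A]) (auto simp: space_F dest: sets_A_subset[THEN subsetD])

lemma subalgebra_pre_sigma:
  assumes "stopping_time A T"
  shows "subalgebra M (pre_sigma T)"
proof -
  have "B \<in> sets M" if "B \<in> sets (pre_sigma T)" for B
    using sets_pre_sigmaD[OF assms that, of \<infinity>] sets_A_subset[of \<infinity>] by auto
  then show ?thesis by (auto simp: subalgebra_def space_pre_sigma)
qed

text \<open>The constant filtration \<open>M\<close> is right-continuous, contains \<open>A\<close>
  and has the measurable \<open>\<rho>\<close> as a stopping time; minimality of
  \<open>enlarge\<close> gives the inclusion.\<close>

lemma subfiltration_enlarge:
  assumes "\<rho> \<in> borel_measurable M"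
  shows "subfiltration M (enlarge (space M) A \<rho>)"
proof -
  have "sets (enlarge (space M) A \<rho> t) \<subseteq> sets ((\<lambda>_. M) t)" for t
  proof (rule enlarge_least[OF filtration_axioms])
    show "filtration (space M) (\<lambda>_::ennreal. M)" by unfold_locales auto
    show "right_continuous_filtration (\<lambda>_. M)"
      unfolding right_continuous_filtration_def
    proof (intro allI impI)
      fix t :: ennreal assume "t < \<infinity>"
      then have "{t<..<\<infinity>} \<noteq> {}" using dense[of t \<infinity>] by auto
      then show "sets M = (\<Inter>u\<in>{t<..<\<infinity>}. sets M)" by simp
    qed
    show "stopping_time (\<lambda>_. M) \<rho>" using assms by (auto simp: stopping_time_def)
  qed (rule sets_A_subset)
  then show ?thesis
    using filtration_enlarge[OF filtration_axioms, of \<rho>] sets_enlarge_infinity[OF filtration_axioms, of \<rho>]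
    by (auto simp: subfiltration_def subfiltration_axioms_def)
qed

text \<open>At infinity \<open>enlarge\<close> is built from finite times only, so the inclusion
  there rests on \<open>A \<infinity>\<close> being generated by its values at finite times.\<close>

lemma sets_subset_enlarge':
  "sets (A t) \<subseteq> sets (enlarge (space M) A \<rho> t)"
proof (cases "t < \<infinity>")
  case True
  then show ?thesis by (rule sets_subset_enlarge[OF filtration_axioms])
next
  case False
  then have t: "t = \<infinity>" by (simp add: not_less top_unique)
  show ?thesis
    unfolding t sets_A_infinity sets_enlarge_infinity[OF filtration_axioms]
    using sets_subset_enlarge[OF filtration_axioms] by (intro sigma_sets_mono' UN_mono) auto
qed

text \<open>\<open>T\<close> remains a stopping time in the larger filtration, where its stopped
  sigma-algebra can only grow; \<open>T \<le> \<rho>\<close> then allows passing to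
  \<open>\<rho>\<close>.\<close>

lemma subalgebra_pre_sigma_enlarge:
  assumes T: "stopping_time A T" and le: "\<And>\<omega>. \<omega> \<in> space M \<Longrightarrow> T \<omega> \<le> \<rho> \<omega>"
  shows "subalgebra (stopped_sigma M (enlarge (space M) A \<rho>) \<rho>) (pre_sigma T)"
proof -
  interpret E: filtration "space M" "enlarge (space M) A \<rho>"
    by (rule filtration_enlarge[OF filtration_axioms])
  have TE: "stopping_time (enlarge (space M) A \<rho>) T"
    using T sets_subset_enlarge'[of _ \<rho>]
    by (auto simp: stopping_time_def pred_def space_F E.space_F)
  have "sets (pre_sigma T) \<subseteq> sets (E.pre_sigma T)"
    unfolding sets_pre_sigma[OF T] E.sets_pre_sigma[OF TE] using sets_subset_enlarge' by blast
  also have "\<dots> \<subseteq> sets (E.pre_sigma \<rho>)"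
    by (rule E.mono_pre_sigma[OF TE stopping_time_enlarge[OF filtration_axioms] le])
  finally show ?thesis by (simp add: subalgebra_def space_pre_sigma E.space_pre_sigma)
qed

end

section \<open>Splitting off the first stop of a strategy\<close>

lemma strategies_1:
  "\<tau>s \<in> strategies \<Omega> 1 \<gamma> A \<sigma> \<longleftrightarrow> (\<exists>\<tau>. \<tau>s = [\<tau>] \<and> \<tau> \<in> stopping_times_ge \<Omega> A \<sigma>)"
  by (auto simp: strategies_def stopping_times_ge_def length_Suc_conv)

text \<open>\<open>enlarges\<close> is a left fold, so enlarging first by the time after the first
  stop and then by the others gives the filtrations of the tail. The recursion starts at one stop,
  since for \<open>m = 0\<close> the definition would speak of \<open>[] ! 0\<close>.\<close>

lemma strategies_Suc:
  assumes "m \<ge> 1"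
  shows "\<tau>s \<in> strategies \<Omega> (Suc m) (d # \<gamma>) A \<sigma> \<longleftrightarrow>
    (\<exists>\<tau> \<tau>s'. \<tau>s = \<tau> # \<tau>s' \<and> \<tau> \<in> stopping_times_ge \<Omega> A \<sigma> \<and>
      \<tau>s' \<in> strategies \<Omega> m \<gamma> (enlarge \<Omega> A (\<lambda>\<omega>. \<tau> \<omega> + d \<omega>)) (\<lambda>\<omega>. \<tau> \<omega> + d \<omega>))"
proof -
  \<comment> \<open>Index 1 becomes the initial condition of the tail; the larger indices are
    shifted and become its later conditions.\<close>
  have split: "(\<forall>i\<in>{1..<Suc m}. P i) \<longleftrightarrow> P 1 \<and> (\<forall>i\<in>{1..<m}. P (Suc i))" for P
  proof -
    have "{1..<Suc m} = insert 1 (Suc ` {1..<m})"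
      unfolding image_Suc_atLeastLessThan using assms by auto
    then show ?thesis by (simp only: ball_simps image_iff) blast
  qed
  have upt: "map f [0..<Suc i] = f 0 # map (\<lambda>j. f (Suc j)) [0..<i]" for f :: "nat \<Rightarrow> 'a \<Rightarrow> ennreal" and i
    by (simp add: map_upt_Suc del: upt_Suc)
  \<comment> \<open>After the shift the predecessor of \<open>Suc i\<close> is \<open>i\<close>,
    which is still positive, so that this entry lies in the tail.\<close>
  have pos: "(\<tau> # \<tau>s') ! i = \<tau>s' ! (i - 1)" if "i \<in> {1..<m}" for i and \<tau> :: "'a \<Rightarrow> ennreal" and \<tau>s'
    using that by (cases i) auto
  have pos': "(d # \<gamma>) ! i = \<gamma> ! (i - 1)" if "i \<in> {1..<m}" for i
    using that by (cases i) auto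
  have "\<tau> # \<tau>s' \<in> strategies \<Omega> (Suc m) (d # \<gamma>) A \<sigma> \<longleftrightarrow> \<tau> \<in> stopping_times_ge \<Omega> A \<sigma> \<and>
      \<tau>s' \<in> strategies \<Omega> m \<gamma> (enlarge \<Omega> A (\<lambda>\<omega>. \<tau> \<omega> + d \<omega>)) (\<lambda>\<omega>. \<tau> \<omega> + d \<omega>)" for \<tau> \<tau>s'
    unfolding strategies_def stopping_times_ge_def split
    by (auto simp: upt enlarges_def pos pos' simp del: upt_Suc)
  moreover have "\<tau>s \<in> strategies \<Omega> (Suc m) (d # \<gamma>) A \<sigma> \<Longrightarrow> \<exists>\<tau> \<tau>s'. \<tau>s = \<tau> # \<tau>s'"
    by (cases \<tau>s) (auto simp: strategies_def)
  ultimately show ?thesis by blast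
qed

lemma strategies_nonempty: "strategies \<Omega> m \<gamma> A \<sigma> \<noteq> {}" if "m \<ge> 1"
proof -
  have "replicate m (\<lambda>_. \<infinity>) \<in> strategies \<Omega> m \<gamma> A \<sigma>"
    using that by (auto simp: strategies_def stopping_time_const)
  then show ?thesis by blast
qed

text \<open>Each stop is measurable with respect to \<open>M\<close>, hence so is the next time to
  be adjoined, and the enlarged filtration stays inside \<open>M\<close>.\<close>

lemma borel_measurable_strategies:
  assumes "subfiltration M A" and "m \<ge> 1" "length \<gamma> = m - 1" "set \<gamma> \<subseteq> borel_measurable M"
    and "\<tau>s \<in> strategies (space M) m \<gamma> A \<sigma>"
  shows "set \<tau>s \<subseteq> borel_measurable M"
  using assms(2,1,3-)
proof (induction m arbitrary: \<gamma> A \<sigma> \<tau>s rule: nat_induct_at_least)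
  case base
  interpret subfiltration M A by fact
  from base show ?case
    unfolding strategies_1 by (auto simp: stopping_times_ge_def borel_measurable_stopping_time)
next
  case (Suc m)
  interpret subfiltration M A by fact
  obtain d \<gamma>' where \<gamma>: "\<gamma> = d # \<gamma>'" using Suc by (cases \<gamma>) auto
  from Suc.prems(4) obtain \<tau> \<tau>s' where \<tau>s: "\<tau>s = \<tau> # \<tau>s'" "\<tau> \<in> stopping_times_ge (space M) A \<sigma>"
    "\<tau>s' \<in> strategies (space M) m \<gamma>' (enlarge (space M) A (\<lambda>\<omega>. \<tau> \<omega> + d \<omega>)) (\<lambda>\<omega>. \<tau> \<omega> + d \<omega>)"
    unfolding \<gamma> strategies_Suc[OF Suc.hyps] by blast
  have [measurable]: "\<tau> \<in> borel_measurable M" "d \<in> borel_measurable M"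
    using \<tau>s(2) Suc.prems(3) by (auto simp: \<gamma> stopping_times_ge_def borel_measurable_stopping_time)
  have "set \<tau>s' \<subseteq> borel_measurable M"
    using Suc.prems \<gamma> by (intro Suc.IH[OF _ _ _ \<tau>s(3)] subfiltration_enlarge) auto
  then show ?case by (simp add: \<tau>s(1))
qed

section \<open>Pasting strategies\<close>

text \<open>On \<open>C\<close>, the filtration \<open>H\<close> is contained in \<open>G\<close> from time \<open>\<rho>\<close> on.  This relation survives the
  enlargement by times that agree on \<open>C\<close>, which carries the induction over the components.\<close>

definition trace_le ::
  "'a set \<Rightarrow> ('a \<Rightarrow> ennreal) \<Rightarrow> (ennreal \<Rightarrow> 'a measure) \<Rightarrow> (ennreal \<Rightarrow> 'a measure) \<Rightarrow> bool" where
  "trace_le C \<rho> H G \<longleftrightarrow> (\<forall>t. \<forall>B\<in>sets (H t). {\<omega>\<in>B. \<omega> \<in> C \<and> \<rho> \<omega> \<le> t} \<in> sets (G t))"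

text \<open>On \<open>C\<close> the events \<open>\<rho>\<^sub>1 \<le> s\<close> and
  \<open>\<rho>\<^sub>2 \<le> s\<close> coincide, so the generators of the two enlargements have the
  same trace there. This extends to the generated sigma-algebras and then to right limits.\<close>

lemma trace_le_enlarge:
  assumes H: "filtration (space M) H" and G: "subfiltration M G" and tr: "trace_le C \<rho> H G"
    and eq: "\<And>\<omega>. \<omega> \<in> C \<Longrightarrow> \<rho>\<^sub>1 \<omega> = \<rho>\<^sub>2 \<omega>"
  shows "trace_le C \<rho> (enlarge (space M) H \<rho>\<^sub>1) (enlarge (space M) G \<rho>\<^sub>2)"
proof -
  interpret H: filtration "space M" H by fact
  interpret G: subfiltration M G by fact
  let ?H = "adjoin_time (space M) H \<rho>\<^sub>1" and ?G = "adjoin_time (space M) G \<rho>\<^sub>2"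
  interpret H': filtration "space M" ?H by (rule filtration_adjoin_time[OF H])
  interpret G': filtration "space M" ?G by (rule filtration_adjoin_time[OF G.filtration_axioms])
  define D where "D t = {\<omega>\<in>space M. \<omega> \<in> C \<and> \<rho> \<omega> \<le> t}" for t
  have sets_H: "sets (?H t) = sigma_sets (space M) (sets (H t) \<union> {{\<omega>\<in>space M. \<rho>\<^sub>1 \<omega> \<le> s} | s. s \<le> t})" for t
    unfolding adjoin_time_def by (rule sets_measure_of[OF adjoin_time_Pow[OF H]])
  have sets_G: "sets (?G t) = sigma_sets (space M) (sets (G t) \<union> {{\<omega>\<in>space M. \<rho>\<^sub>2 \<omega> \<le> s} | s. s \<le> t})" for t
    unfolding adjoin_time_def by (rule sets_measure_of[OF adjoin_time_Pow[OF G.filtration_axioms]])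
  have GG: "sets (G t) \<subseteq> sets (?G t)" for t unfolding sets_G by auto
  \<comment> \<open>The whole space belongs to \<open>H t\<close>, so \<open>trace_le\<close> itself
    contains the measurability of the event on which traces are taken.\<close>
  have D: "D t \<in> sets (G t)" for t
    using tr sets.top[of "H t"] by (auto simp: trace_le_def D_def H.space_F)
  have trD: "D t \<inter> B \<in> sets (G t)" if "B \<in> sets (H t)" for t B
  proof -
    have "{\<omega>\<in>B. \<omega> \<in> C \<and> \<rho> \<omega> \<le> t} = D t \<inter> B"
      using sets.sets_into_space[OF that] by (auto simp: D_def H.space_F)
    then show ?thesis using tr that by (fastforce simp: trace_le_def)
  qed
  have adj: "D u \<inter> B \<in> sets (?G u)" if "B \<in> sets (?H u)" for u B
    using that unfolding sets_H
  proof induction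
    case (Basic B)
    then consider "B \<in> sets (H u)" | s where "s \<le> u" "B = {\<omega>\<in>space M. \<rho>\<^sub>1 \<omega> \<le> s}" by blast
    then show ?case
    proof cases
      case 1
      then show ?thesis using trD GG by blast
    next
      case 2
      have "{\<omega>\<in>space M. \<rho>\<^sub>2 \<omega> \<le> s} \<in> sets (?G u)" using 2(1) by (auto simp: sets_G)
      then have "D u \<inter> {\<omega>\<in>space M. \<rho>\<^sub>2 \<omega> \<le> s} \<in> sets (?G u)" using D GG by blast
      moreover have "D u \<inter> B = D u \<inter> {\<omega>\<in>space M. \<rho>\<^sub>2 \<omega> \<le> s}" using eq by (auto simp: 2 D_def)
      ultimately show ?thesis by simp
    qed
  next
    case Empty
    then show ?case by simp
  next
    case (Compl B)
    \<comment> \<open>The complement is taken inside \<open>D u\<close>, because \<open>B\<close>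
      alone need not be measurable for the second filtration.\<close>
    have "D u - D u \<inter> B \<in> sets (?G u)" using Compl D GG by blast
    moreover have "D u \<inter> (space M - B) = D u - D u \<inter> B" by (auto simp: D_def)
    ultimately show ?case by simp
  next
    case (Union B)
    then show ?case by (simp add: Int_UN_distrib del: UN_simps)
  qed
  show ?thesis
    unfolding trace_le_def
  proof (intro allI ballI)
    fix t B assume B: "B \<in> sets (enlarge (space M) H \<rho>\<^sub>1 t)"
    have "D t \<inter> B \<in> sets (enlarge (space M) G \<rho>\<^sub>2 t)"
    proof (cases "t < \<infinity>")
      case True
      show ?thesis
        unfolding sets_enlarge(1)[OF G.filtration_axioms True]
      proof
        \<comment> \<open>\<open>adj\<close> handles the trace on \<open>D u\<close>; cutting
          further by the smaller \<open>D t\<close>, which is already known at \<open>t\<close>,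
          recovers the trace at \<open>t\<close> for every later \<open>u\<close>.\<close>
        fix u assume u: "u \<in> {t<..<\<infinity>}"
        with B have "B \<in> sets (?H u)" unfolding sets_enlarge(1)[OF H True] by blast
        moreover have "D t \<in> sets (?G u)"
          using D[of t] GG[of u] G.sets_F_mono[of t u] u by (auto dest: less_imp_le)
        ultimately have "D t \<inter> (D u \<inter> B) \<in> sets (?G u)" by (intro sets.Int adj)
        moreover have "D t \<inter> (D u \<inter> B) = D t \<inter> B" using u by (auto simp: D_def)
        ultimately show "D t \<inter> B \<in> sets (?G u)" by simp
      qed
    next
      case False
      then have t: "t = \<infinity>" by (simp add: not_less top_unique)
      have "(\<Union>u\<in>{..<\<infinity>}. sets (?H u)) \<subseteq> sets (?H \<infinity>)"
        by (intro UN_least H'.sets_F_mono) simp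
      from sets.sigma_sets_subset[OF this] have "B \<in> sets (?H \<infinity>)"
        using B unfolding t sets_enlarge(2)[OF H] by (auto simp: H'.space_F)
      then have "D t \<inter> B \<in> sets (?G \<infinity>)" unfolding t by (rule adj)
      also have "sets (?G \<infinity>) \<subseteq> sets (enlarge (space M) G \<rho>\<^sub>2 \<infinity>)"
      proof -
        let ?E = "enlarge (space M) G \<rho>\<^sub>2"
        interpret E: filtration "space M" ?E by (rule filtration_enlarge[OF G.filtration_axioms])
        have "{\<omega>\<in>space M. \<rho>\<^sub>2 \<omega> \<le> s} \<in> sets (?E \<infinity>)" for s
          using E.stopping_time_le_const[OF stopping_time_enlarge[OF G.filtration_axioms], of s \<infinity>]
          by (simp add: pred_def E.space_F)
        then have "sets (G \<infinity>) \<union> {{\<omega>\<in>space M. \<rho>\<^sub>2 \<omega> \<le> s} | s. s \<le> \<infinity>} \<subseteq> sets (?E \<infinity>)"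
          using G.sets_subset_enlarge'[of \<infinity> \<rho>\<^sub>2] by blast
        from sets.sigma_sets_subset[OF this] show ?thesis unfolding sets_G E.space_F .
      qed
      finally show ?thesis unfolding t .
    qed
    moreover have "{\<omega>\<in>B. \<omega> \<in> C \<and> \<rho> \<omega> \<le> t} = D t \<inter> B"
      using sets.sets_into_space[OF B] by (auto simp: D_def sets_enlarge(3)[OF H])
    ultimately show "{\<omega>\<in>B. \<omega> \<in> C \<and> \<rho> \<omega> \<le> t} \<in> sets (enlarge (space M) G \<rho>\<^sub>2 t)" by simp
  qed
qed

definition paste :: "'a set \<Rightarrow> ('a \<Rightarrow> ennreal) \<Rightarrow> ('a \<Rightarrow> ennreal) \<Rightarrow> 'a \<Rightarrow> ennreal" where
  "paste C f g \<omega> = (if \<omega> \<in> C then f \<omega> else g \<omega>)"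

text \<open>Since both times lie after \<open>\<rho>\<close>, intersecting
  \<open>\<tau>\<^sub>1 \<le> t\<close> with \<open>\<rho> \<le> t\<close> changes nothing. The
  event that the pasted time is at most \<open>t\<close> is thus a union of two traces covered by
  \<open>trace_le\<close>.\<close>

lemma stopping_times_ge_paste:
  assumes H: "filtration (space M) H\<^sub>1" "filtration (space M) H\<^sub>2" and G: "filtration (space M) G"
    and tr: "trace_le C \<rho> H\<^sub>1 G" "trace_le (space M - C) \<rho> H\<^sub>2 G"
    and \<tau>: "\<tau>\<^sub>1 \<in> stopping_times_ge (space M) H\<^sub>1 \<sigma>\<^sub>1" "\<tau>\<^sub>2 \<in> stopping_times_ge (space M) H\<^sub>2 \<sigma>\<^sub>2"
    and le: "\<And>\<omega>. \<omega> \<in> space M \<Longrightarrow> \<rho> \<omega> \<le> \<sigma>\<^sub>1 \<omega>" "\<And>\<omega>. \<omega> \<in> space M \<Longrightarrow> \<rho> \<omega> \<le> \<sigma>\<^sub>2 \<omega>"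
  shows "paste C \<tau>\<^sub>1 \<tau>\<^sub>2 \<in> stopping_times_ge (space M) G (paste C \<sigma>\<^sub>1 \<sigma>\<^sub>2)"
proof -
  interpret H1: filtration "space M" H\<^sub>1 by fact
  interpret H2: filtration "space M" H\<^sub>2 by fact
  interpret G: filtration "space M" G by fact
  have "{\<omega>\<in>space M. paste C \<tau>\<^sub>1 \<tau>\<^sub>2 \<omega> \<le> t} \<in> sets (G t)" for t
  proof -
    have "{\<omega>\<in>space M. \<tau>\<^sub>1 \<omega> \<le> t} \<in> sets (H\<^sub>1 t)" "{\<omega>\<in>space M. \<tau>\<^sub>2 \<omega> \<le> t} \<in> sets (H\<^sub>2 t)"
      using \<tau> by (auto simp: stopping_times_ge_def stopping_time_def pred_def H1.space_F H2.space_F)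
    then have "{\<omega>\<in>{\<omega>\<in>space M. \<tau>\<^sub>1 \<omega> \<le> t}. \<omega> \<in> C \<and> \<rho> \<omega> \<le> t} \<union>
        {\<omega>\<in>{\<omega>\<in>space M. \<tau>\<^sub>2 \<omega> \<le> t}. \<omega> \<in> space M - C \<and> \<rho> \<omega> \<le> t} \<in> sets (G t)"
      using tr unfolding trace_le_def by (intro sets.Un) blast+
    moreover have "\<rho> \<omega> \<le> \<tau>\<^sub>1 \<omega>" "\<rho> \<omega> \<le> \<tau>\<^sub>2 \<omega>" if "\<omega> \<in> space M" for \<omega>
      using that le[OF that] \<tau> by (auto simp: stopping_times_ge_def intro: order_trans)
    then have "{\<omega>\<in>space M. paste C \<tau>\<^sub>1 \<tau>\<^sub>2 \<omega> \<le> t} =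
        {\<omega>\<in>{\<omega>\<in>space M. \<tau>\<^sub>1 \<omega> \<le> t}. \<omega> \<in> C \<and> \<rho> \<omega> \<le> t} \<union>
        {\<omega>\<in>{\<omega>\<in>space M. \<tau>\<^sub>2 \<omega> \<le> t}. \<omega> \<in> space M - C \<and> \<rho> \<omega> \<le> t}"
      by (auto simp: paste_def split: if_splits intro: order_trans)
    ultimately show ?thesis by simp
  qed
  then show ?thesis
    using \<tau> by (auto simp: stopping_times_ge_def stopping_time_def pred_def G.space_F paste_def)
qed

text \<open>Two filtrations \<open>H\<^sub>1\<close> and \<open>H\<^sub>2\<close> are needed for the
  induction: after the first stop the two strategies live in different enlargements. The time
  \<open>\<rho>\<close> stays fixed while the starting times move on.\<close>

lemma strategies_paste:
  assumes "m \<ge> 1" "length \<gamma> = m - 1" "set \<gamma> \<subseteq> borel_measurable M"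
    and "subfiltration M H\<^sub>1" "subfiltration M H\<^sub>2" "subfiltration M G"
    and "trace_le C \<rho> H\<^sub>1 G" "trace_le (space M - C) \<rho> H\<^sub>2 G"
    and "\<tau>s\<^sub>1 \<in> strategies (space M) m \<gamma> H\<^sub>1 \<sigma>\<^sub>1" "\<tau>s\<^sub>2 \<in> strategies (space M) m \<gamma> H\<^sub>2 \<sigma>\<^sub>2"
    and "\<And>\<omega>. \<omega> \<in> space M \<Longrightarrow> \<rho> \<omega> \<le> \<sigma>\<^sub>1 \<omega>" "\<And>\<omega>. \<omega> \<in> space M \<Longrightarrow> \<rho> \<omega> \<le> \<sigma>\<^sub>2 \<omega>"
  shows "map2 (paste C) \<tau>s\<^sub>1 \<tau>s\<^sub>2 \<in> strategies (space M) m \<gamma> G (paste C \<sigma>\<^sub>1 \<sigma>\<^sub>2)"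
  using assms
proof (induction m arbitrary: \<gamma> H\<^sub>1 H\<^sub>2 G \<sigma>\<^sub>1 \<sigma>\<^sub>2 \<tau>s\<^sub>1 \<tau>s\<^sub>2 rule: nat_induct_at_least)
  case base
  then obtain \<tau>\<^sub>1 \<tau>\<^sub>2 where "\<tau>s\<^sub>1 = [\<tau>\<^sub>1]" "\<tau>s\<^sub>2 = [\<tau>\<^sub>2]"
    "\<tau>\<^sub>1 \<in> stopping_times_ge (space M) H\<^sub>1 \<sigma>\<^sub>1" "\<tau>\<^sub>2 \<in> stopping_times_ge (space M) H\<^sub>2 \<sigma>\<^sub>2"
    unfolding strategies_1 by blast
  moreover from this have "paste C \<tau>\<^sub>1 \<tau>\<^sub>2 \<in> stopping_times_ge (space M) G (paste C \<sigma>\<^sub>1 \<sigma>\<^sub>2)"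
    using base by (intro stopping_times_ge_paste[where \<rho> = \<rho> and H\<^sub>1 = H\<^sub>1 and H\<^sub>2 = H\<^sub>2])
      (auto intro: subfiltration.axioms(1))
  ultimately show ?case unfolding strategies_1 by simp
next
  case (Suc m)
  obtain d \<gamma>' where \<gamma>: "\<gamma> = d # \<gamma>'" using Suc by (cases \<gamma>) auto
  interpret H1: subfiltration M H\<^sub>1 by fact
  interpret H2: subfiltration M H\<^sub>2 by fact
  interpret G: subfiltration M G by fact
  obtain \<tau>\<^sub>1 \<tau>s\<^sub>1' where 1: "\<tau>s\<^sub>1 = \<tau>\<^sub>1 # \<tau>s\<^sub>1'" "\<tau>\<^sub>1 \<in> stopping_times_ge (space M) H\<^sub>1 \<sigma>\<^sub>1"
    "\<tau>s\<^sub>1' \<in> strategies (space M) m \<gamma>' (enlarge (space M) H\<^sub>1 (\<lambda>\<omega>. \<tau>\<^sub>1 \<omega> + d \<omega>)) (\<lambda>\<omega>. \<tau>\<^sub>1 \<omega> + d \<omega>)"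
    using Suc.prems(8) unfolding \<gamma> strategies_Suc[OF Suc.hyps] by blast
  obtain \<tau>\<^sub>2 \<tau>s\<^sub>2' where 2: "\<tau>s\<^sub>2 = \<tau>\<^sub>2 # \<tau>s\<^sub>2'" "\<tau>\<^sub>2 \<in> stopping_times_ge (space M) H\<^sub>2 \<sigma>\<^sub>2"
    "\<tau>s\<^sub>2' \<in> strategies (space M) m \<gamma>' (enlarge (space M) H\<^sub>2 (\<lambda>\<omega>. \<tau>\<^sub>2 \<omega> + d \<omega>)) (\<lambda>\<omega>. \<tau>\<^sub>2 \<omega> + d \<omega>)"
    using Suc.prems(9) unfolding \<gamma> strategies_Suc[OF Suc.hyps] by blast
  have paste: "paste C \<tau>\<^sub>1 \<tau>\<^sub>2 \<in> stopping_times_ge (space M) G (paste C \<sigma>\<^sub>1 \<sigma>\<^sub>2)"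
    by (rule stopping_times_ge_paste[OF H1.filtration_axioms H2.filtration_axioms
          G.filtration_axioms Suc.prems(6,7) 1(2) 2(2) Suc.prems(10,11)])
  \<comment> \<open>The waiting time is common to both strategies, so the pasted time to be adjoined
    agrees with the first on \<open>C\<close> and with the second off \<open>C\<close>.\<close>
  have add: "(\<lambda>\<omega>. paste C \<tau>\<^sub>1 \<tau>\<^sub>2 \<omega> + d \<omega>) = paste C (\<lambda>\<omega>. \<tau>\<^sub>1 \<omega> + d \<omega>) (\<lambda>\<omega>. \<tau>\<^sub>2 \<omega> + d \<omega>)"
    by (auto simp: paste_def)
  have [measurable]: "\<tau>\<^sub>1 \<in> borel_measurable M" "\<tau>\<^sub>2 \<in> borel_measurable M"
      "paste C \<tau>\<^sub>1 \<tau>\<^sub>2 \<in> borel_measurable M" "d \<in> borel_measurable M"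
    using 1(2) 2(2) paste Suc.prems(2)
      H1.borel_measurable_stopping_time H2.borel_measurable_stopping_time
      G.borel_measurable_stopping_time by (auto simp: \<gamma> stopping_times_ge_def)
  have le: "\<rho> \<omega> \<le> \<tau>\<^sub>1 \<omega> + d \<omega>" "\<rho> \<omega> \<le> \<tau>\<^sub>2 \<omega> + d \<omega>" if "\<omega> \<in> space M" for \<omega>
    using 1(2) 2(2) Suc.prems(10,11)[OF that] that
    by (auto simp: stopping_times_ge_def intro!: add_increasing2 intro: order_trans)
  have "map2 (paste C) \<tau>s\<^sub>1' \<tau>s\<^sub>2' \<in> strategies (space M) m \<gamma>'
      (enlarge (space M) G (\<lambda>\<omega>. paste C \<tau>\<^sub>1 \<tau>\<^sub>2 \<omega> + d \<omega>))
      (paste C (\<lambda>\<omega>. \<tau>\<^sub>1 \<omega> + d \<omega>) (\<lambda>\<omega>. \<tau>\<^sub>2 \<omega> + d \<omega>))"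
  proof (rule Suc.IH[OF _ _ _ _ _ _ _ 1(3) 2(3)])
    show "length \<gamma>' = m - 1" "set \<gamma>' \<subseteq> borel_measurable M" using Suc.prems(1,2) \<gamma> by auto
    show "trace_le C \<rho> (enlarge (space M) H\<^sub>1 (\<lambda>\<omega>. \<tau>\<^sub>1 \<omega> + d \<omega>))
        (enlarge (space M) G (\<lambda>\<omega>. paste C \<tau>\<^sub>1 \<tau>\<^sub>2 \<omega> + d \<omega>))"
      by (rule trace_le_enlarge[OF H1.filtration_axioms Suc.prems(5,6)]) (simp add: paste_def)
    show "trace_le (space M - C) \<rho> (enlarge (space M) H\<^sub>2 (\<lambda>\<omega>. \<tau>\<^sub>2 \<omega> + d \<omega>))
        (enlarge (space M) G (\<lambda>\<omega>. paste C \<tau>\<^sub>1 \<tau>\<^sub>2 \<omega> + d \<omega>))"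
      by (rule trace_le_enlarge[OF H2.filtration_axioms Suc.prems(5,7)]) (simp add: paste_def)
  qed (auto intro!: H1.subfiltration_enlarge H2.subfiltration_enlarge G.subfiltration_enlarge le)
  with paste show ?case
    unfolding \<gamma> strategies_Suc[OF Suc.hyps] by (auto simp: 1(1) 2(1) add[symmetric])
qed

section \<open>The dynamic programming principle\<close>

lemma (in prob_space) sigma_finite_subalgebra_if_subalgebra:
  assumes "subalgebra M G"
  shows "sigma_finite_subalgebra M G"
  by (rule finite_measure_subalgebra_is_sigma_finite)
    (simp add: finite_measure_subalgebra_def finite_measure_subalgebra_axioms_def assms finite_measure_axioms)

lemma (in usual_filtered_prob_space) subfiltration_F: "subfiltration M F"
  by unfold_locales (rule sets_F_subset, rule sets_F_infinity)

lemma total_reward_Cons: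
  "total_reward Y (\<tau> # \<tau>s) = (\<lambda>\<omega>. reward Y (\<tau> \<omega>) \<omega> + total_reward Y \<tau>s \<omega>)"
  by (auto simp: total_reward_def lessThan_Suc_atMost[symmetric] sum.lessThan_Suc_shift simp del: sum.lessThan_Suc)

lemma total_reward_paste:
  assumes "length \<tau>s\<^sub>1 = length \<tau>s\<^sub>2"
  shows "total_reward Y (map2 (paste C) \<tau>s\<^sub>1 \<tau>s\<^sub>2) =
    (\<lambda>\<omega>. if \<omega> \<in> C then total_reward Y \<tau>s\<^sub>1 \<omega> else total_reward Y \<tau>s\<^sub>2 \<omega>)"
  using assms by (auto simp: total_reward_def paste_def)

lemma (in finite_measure) nn_cond_exp_le_val:
  assumes "m \<ge> 1" "\<tau>s \<in> strategies (space M) m \<gamma> G \<rho>"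
  shows "AE \<omega> in M. nn_cond_exp M (stopped_sigma M G \<rho>) (total_reward Y \<tau>s) \<omega> \<le> val M Y m \<gamma> G \<rho> \<omega>"
proof -
  let ?\<Phi> = "{nn_cond_exp M (stopped_sigma M G \<rho>) (total_reward Y \<tau>s) | \<tau>s. \<tau>s \<in> strategies (space M) m \<gamma> G \<rho>}"
  have "is_ess_sup M ?\<Phi> (ess_sup M ?\<Phi>)" by (rule is_ess_sup_ess_sup) auto
  with assms show ?thesis unfolding val_def is_ess_sup_def by auto
qed

lemma (in finite_measure) borel_measurable_val: "val M Y m \<gamma> G \<rho> \<in> borel_measurable M"
proof -
  let ?\<Phi> = "{nn_cond_exp M (stopped_sigma M G \<rho>) (total_reward Y \<tau>s) | \<tau>s. \<tau>s \<in> strategies (space M) m \<gamma> G \<rho>}"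
  have "is_ess_sup M ?\<Phi> (ess_sup M ?\<Phi>)" by (rule is_ess_sup_ess_sup) auto
  then show ?thesis unfolding val_def is_ess_sup_def by auto
qed

section \<open>Exchanging the continuation value with conditional expectations\<close>

context reward_process
begin

text \<open>The conditional rewards form a directed family with bounded integrals: pasting two
  strategies along the event that compares them attains the maximum of their conditional
  rewards.\<close>

lemma val_eq_SUP:
  assumes G: "subfiltration M G" and \<rho>: "stopping_time G \<rho>"
    and m: "m \<ge> 1" "length \<gamma> = m - 1" "set \<gamma> \<subseteq> borel_measurable M"
  obtains \<tau>s :: "nat \<Rightarrow> ('a \<Rightarrow> ennreal) list"
  where "\<And>i. \<tau>s i \<in> strategies (space M) m \<gamma> G \<rho>"
    and "\<And>i. AE \<omega> in M. nn_cond_exp M (stopped_sigma M G \<rho>) (total_reward Y (\<tau>s i)) \<omega>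
      \<le> nn_cond_exp M (stopped_sigma M G \<rho>) (total_reward Y (\<tau>s (Suc i))) \<omega>"
    and "AE \<omega> in M. val M Y m \<gamma> G \<rho> \<omega> =
      (SUP i. nn_cond_exp M (stopped_sigma M G \<rho>) (total_reward Y (\<tau>s i)) \<omega>)"
proof -
  interpret G: subfiltration M G by fact
  interpret P: sigma_finite_subalgebra M "G.pre_sigma \<rho>"
    by (rule sigma_finite_subalgebra_if_subalgebra[OF G.subalgebra_pre_sigma[OF \<rho>]])
  let ?S = "strategies (space M) m \<gamma> G \<rho>"
  let ?E = "\<lambda>\<tau>s. nn_cond_exp M (G.pre_sigma \<rho>) (total_reward Y \<tau>s)"
  let ?c = "of_nat m * (\<integral>\<^sup>+\<omega>. (SUP t\<in>{0..}. ennreal (Y t \<omega>)) \<partial>M)"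
  have meas: "set \<tau>s \<subseteq> borel_measurable M" if "\<tau>s \<in> ?S" for \<tau>s
    using borel_measurable_strategies[OF G m that] .
  have val: "val M Y m \<gamma> G \<rho> = ess_sup M {?E \<tau>s | \<tau>s. \<tau>s \<in> ?S}"
    using m(1) by (auto simp: val_def)
  obtain X where X: "\<And>i. X i \<in> {?E \<tau>s | \<tau>s. \<tau>s \<in> ?S}" "\<And>i. AE \<omega> in M. X i \<omega> \<le> X (Suc i) \<omega>"
    "AE \<omega> in M. ess_sup M {?E \<tau>s | \<tau>s. \<tau>s \<in> ?S} \<omega> = (SUP i. X i \<omega>)"
  proof (rule ess_sup_directed)
    show "{?E \<tau>s | \<tau>s. \<tau>s \<in> ?S} \<noteq> {}" using strategies_nonempty[OF m(1)] by blast
    show "{?E \<tau>s | \<tau>s. \<tau>s \<in> ?S} \<subseteq> borel_measurable M" by auto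
    show "?c < \<infinity>" using sup_integrable by (auto simp: ennreal_mult_less_top ennreal_of_nat_eq_real_of_nat)
    show "(\<integral>\<^sup>+\<omega>. X \<omega> \<partial>M) \<le> ?c" if "X \<in> {?E \<tau>s | \<tau>s. \<tau>s \<in> ?S}" for X
    proof -
      obtain \<tau>s where \<tau>s: "\<tau>s \<in> ?S" "X = ?E \<tau>s" using \<open>X \<in> _\<close> by blast
      then have "length \<tau>s = m" by (simp add: strategies_def)
      then show ?thesis
        using nn_integral_total_reward_le[OF meas[OF \<tau>s(1)]]
        by (simp add: \<tau>s(2) P.nn_integral_nn_cond_exp borel_measurable_total_reward meas[OF \<tau>s(1)])
    qed
    fix X\<^sub>1 X\<^sub>2 assume "X\<^sub>1 \<in> {?E \<tau>s | \<tau>s. \<tau>s \<in> ?S}" "X\<^sub>2 \<in> {?E \<tau>s | \<tau>s. \<tau>s \<in> ?S}"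
    then obtain \<tau>s\<^sub>1 \<tau>s\<^sub>2 where 1: "\<tau>s\<^sub>1 \<in> ?S" "X\<^sub>1 = ?E \<tau>s\<^sub>1" and 2: "\<tau>s\<^sub>2 \<in> ?S" "X\<^sub>2 = ?E \<tau>s\<^sub>2"
      by blast
    define C where "C = {\<omega>\<in>space (G.pre_sigma \<rho>). X\<^sub>2 \<omega> \<le> X\<^sub>1 \<omega>}"
    have C: "C \<in> sets (G.pre_sigma \<rho>)" unfolding C_def 1(2) 2(2) by measurable
    \<comment> \<open>For events of the stopped sigma-algebra the trace condition is their defining
      property, intersected with \<open>B\<close>.\<close>
    have trace: "trace_le D \<rho> G G" if "D \<in> sets (G.pre_sigma \<rho>)" for D
      unfolding trace_le_def
    proof (intro allI ballI)
      fix t B assume "B \<in> sets (G t)"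
      with G.sets_pre_sigmaD[OF \<rho> that, of t] have "B \<inter> {\<omega>\<in>D. \<rho> \<omega> \<le> t} \<in> sets (G t)" by blast
      moreover have "B \<inter> {\<omega>\<in>D. \<rho> \<omega> \<le> t} = {\<omega>\<in>B. \<omega> \<in> D \<and> \<rho> \<omega> \<le> t}" by blast
      ultimately show "{\<omega>\<in>B. \<omega> \<in> D \<and> \<rho> \<omega> \<le> t} \<in> sets (G t)" by simp
    qed
    have "space M - C \<in> sets (G.pre_sigma \<rho>)"
      using sets.compl_sets[OF C] by (simp add: G.space_pre_sigma)
    then have "map2 (paste C) \<tau>s\<^sub>1 \<tau>s\<^sub>2 \<in> strategies (space M) m \<gamma> G (paste C \<rho> \<rho>)"
      by (intro strategies_paste[OF m G G G trace trace 1(1) 2(1)] C) auto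
    moreover have "paste C \<rho> \<rho> = \<rho>" by (auto simp: paste_def)
    ultimately have S: "map2 (paste C) \<tau>s\<^sub>1 \<tau>s\<^sub>2 \<in> ?S" by simp
    have "length \<tau>s\<^sub>1 = length \<tau>s\<^sub>2" using 1(1) 2(1) by (simp add: strategies_def)
    then have "AE \<omega> in M. ?E (map2 (paste C) \<tau>s\<^sub>1 \<tau>s\<^sub>2) \<omega> = (if \<omega> \<in> C then X\<^sub>1 \<omega> else X\<^sub>2 \<omega>)"
      unfolding 1(2) 2(2) total_reward_paste[OF \<open>length \<tau>s\<^sub>1 = length \<tau>s\<^sub>2\<close>]
      by (intro P.nn_cond_exp_if C borel_measurable_total_reward meas 1(1) 2(1))
    then have "AE \<omega> in M. max (X\<^sub>1 \<omega>) (X\<^sub>2 \<omega>) \<le> ?E (map2 (paste C) \<tau>s\<^sub>1 \<tau>s\<^sub>2) \<omega>"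
      using AE_space by eventually_elim (auto simp: C_def G.space_pre_sigma)
    with S show "\<exists>Z\<in>{?E \<tau>s | \<tau>s. \<tau>s \<in> ?S}. AE \<omega> in M. max (X\<^sub>1 \<omega>) (X\<^sub>2 \<omega>) \<le> Z \<omega>" by blast
  qed (rule that)
  from X(1) have "\<forall>i. \<exists>\<tau>s\<in>?S. X i = ?E \<tau>s" by blast
  then obtain \<tau>s where "\<And>i. \<tau>s i \<in> ?S" "\<And>i. X i = ?E (\<tau>s i)" by metis
  with X(2,3) show thesis by (intro that[of \<tau>s]) (auto simp: val)
qed

text \<open>For a fixed first stop, bounding the rewards of all continuations is the same as
  bounding the reward of the continuation value. One direction writes the value as an increasing
  limit and uses conditional monotone convergence; the other uses that the value dominates every
  continuation.\<close>

lemma continuation_le_iff: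
  assumes \<sigma>: "stopping_time F \<sigma>" and \<tau>: "\<tau> \<in> stopping_times_ge (space M) F \<sigma>"
    and m: "m \<ge> 1" "length \<gamma> = m - 1" "set \<gamma> \<subseteq> borel_measurable M" and d: "d \<in> borel_measurable M"
  defines "\<rho> \<equiv> \<lambda>\<omega>. \<tau> \<omega> + d \<omega>"
  defines "G \<equiv> enlarge (space M) F \<rho>"
  shows "(\<forall>\<tau>s\<in>strategies (space M) m \<gamma> G \<rho>.
      AE \<omega> in M. nn_cond_exp M (pre_sigma \<sigma>) (total_reward Y (\<tau> # \<tau>s)) \<omega> \<le> W \<omega>) \<longleftrightarrow>
    (AE \<omega> in M. nn_cond_exp M (pre_sigma \<sigma>)
      (\<lambda>\<omega>. reward Y (\<tau> \<omega>) \<omega> + nn_cond_exp M (pre_sigma \<tau>) (val M Y m \<gamma> G \<rho>) \<omega>) \<omega> \<le> W \<omega>)"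
    (is "?L \<longleftrightarrow> ?R")
proof -
  interpret SF: subfiltration M F by (rule subfiltration_F)
  have \<tau>': "stopping_time F \<tau>" and \<sigma>\<tau>: "\<And>\<omega>. \<omega> \<in> space M \<Longrightarrow> \<sigma> \<omega> \<le> \<tau> \<omega>"
    using \<tau> by (auto simp: stopping_times_ge_def)
  have [measurable]: "\<tau> \<in> borel_measurable M" by (rule SF.borel_measurable_stopping_time[OF \<tau>'])
  have \<rho>_meas: "\<rho> \<in> borel_measurable M" unfolding \<rho>_def using d by measurable
  have G: "subfiltration M G" unfolding G_def by (rule SF.subfiltration_enlarge[OF \<rho>_meas])
  interpret G: subfiltration M G by (rule G)
  have \<rho>: "stopping_time G \<rho>" unfolding G_def by (rule stopping_time_enlarge[OF filtration_axioms])
  interpret S: sigma_finite_subalgebra M "pre_sigma \<sigma>"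
    by (rule sigma_finite_subalgebra_if_subalgebra[OF SF.subalgebra_pre_sigma[OF \<sigma>]])
  have sub: "subalgebra M (pre_sigma \<tau>)" "subalgebra (pre_sigma \<tau>) (pre_sigma \<sigma>)"
    "subalgebra M (G.pre_sigma \<rho>)" "subalgebra (G.pre_sigma \<rho>) (pre_sigma \<sigma>)"
  proof -
    show "subalgebra M (pre_sigma \<tau>)" "subalgebra M (G.pre_sigma \<rho>)"
      by (rule SF.subalgebra_pre_sigma[OF \<tau>'], rule G.subalgebra_pre_sigma[OF \<rho>])
    show "subalgebra (pre_sigma \<tau>) (pre_sigma \<sigma>)"
      using mono_pre_sigma[OF \<sigma> \<tau>' \<sigma>\<tau>] by (simp add: subalgebra_def space_pre_sigma)
    show "subalgebra (G.pre_sigma \<rho>) (pre_sigma \<sigma>)"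
      unfolding G_def
      by (rule SF.subalgebra_pre_sigma_enlarge[OF \<sigma>]) (auto simp: \<rho>_def intro: add_increasing2 \<sigma>\<tau>)
  qed
  let ?r = "\<lambda>\<omega>. reward Y (\<tau> \<omega>) \<omega>" and ?Z = "val M Y m \<gamma> G \<rho>"
  let ?S = "strategies (space M) m \<gamma> G \<rho>"
  let ?E = "\<lambda>\<tau>s. nn_cond_exp M (G.pre_sigma \<rho>) (total_reward Y \<tau>s)"
  have [measurable]: "?r \<in> borel_measurable M" by (rule borel_measurable_reward) measurable
  have [measurable]: "?Z \<in> borel_measurable M" by (rule borel_measurable_val)
  have L: "AE \<omega> in M. nn_cond_exp M (pre_sigma \<sigma>) (\<lambda>\<omega>. ?r \<omega> + ?E \<tau>s \<omega>) \<omega>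
      = nn_cond_exp M (pre_sigma \<sigma>) (total_reward Y (\<tau> # \<tau>s)) \<omega>" if "\<tau>s \<in> ?S" for \<tau>s
    unfolding total_reward_Cons
    by (rule S.nn_cond_exp_add_nested[OF sub(3,4)])
       (measurable, rule borel_measurable_total_reward[OF borel_measurable_strategies[OF G m that]])
  have R: "AE \<omega> in M. nn_cond_exp M (pre_sigma \<sigma>) (\<lambda>\<omega>. ?r \<omega> + nn_cond_exp M (pre_sigma \<tau>) ?Z \<omega>) \<omega>
      = nn_cond_exp M (pre_sigma \<sigma>) (\<lambda>\<omega>. ?r \<omega> + ?Z \<omega>) \<omega>"
    by (rule S.nn_cond_exp_add_nested[OF sub(1,2)]) measurable
  show ?thesis
  proof
    assume ?L
    obtain \<tau>s where \<tau>s: "\<And>i. \<tau>s i \<in> ?S" "\<And>i. AE \<omega> in M. ?E (\<tau>s i) \<omega> \<le> ?E (\<tau>s (Suc i)) \<omega>"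
      "AE \<omega> in M. ?Z \<omega> = (SUP i. ?E (\<tau>s i) \<omega>)"
      by (rule val_eq_SUP[OF G \<rho> m]) (rule that)
    have "AE \<omega> in M. ?r \<omega> + ?Z \<omega> = (SUP i. ?r \<omega> + ?E (\<tau>s i) \<omega>)"
      using \<tau>s(3) by eventually_elim (simp add: ennreal_SUP_add_right)
    then have "AE \<omega> in M. nn_cond_exp M (pre_sigma \<sigma>) (\<lambda>\<omega>. ?r \<omega> + ?Z \<omega>) \<omega>
        = nn_cond_exp M (pre_sigma \<sigma>) (\<lambda>\<omega>. SUP i. ?r \<omega> + ?E (\<tau>s i) \<omega>) \<omega>"
      by (rule S.nn_cond_exp_cong) measurable
    moreover have "AE \<omega> in M. nn_cond_exp M (pre_sigma \<sigma>) (\<lambda>\<omega>. SUP i. ?r \<omega> + ?E (\<tau>s i) \<omega>) \<omega>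
        = (SUP i. nn_cond_exp M (pre_sigma \<sigma>) (\<lambda>\<omega>. ?r \<omega> + ?E (\<tau>s i) \<omega>) \<omega>)"
    proof (rule S.nn_cond_exp_SUP)
      show "AE \<omega> in M. ?r \<omega> + ?E (\<tau>s i) \<omega> \<le> ?r \<omega> + ?E (\<tau>s (Suc i)) \<omega>" for i
        using \<tau>s(2)[of i] by eventually_elim (rule add_left_mono)
    qed measurable
    \<comment> \<open>Only the countably many strategies of the maximizing sequence enter, so their
      exceptional null sets can be united.\<close>
    moreover have "AE \<omega> in M. \<forall>i. nn_cond_exp M (pre_sigma \<sigma>) (\<lambda>\<omega>. ?r \<omega> + ?E (\<tau>s i) \<omega>) \<omega> \<le> W \<omega>"
      unfolding AE_all_countable
    proof
      fix i
      have "AE \<omega> in M. nn_cond_exp M (pre_sigma \<sigma>) (total_reward Y (\<tau> # \<tau>s i)) \<omega> \<le> W \<omega>"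
        using \<open>?L\<close> \<tau>s(1) by blast
      with L[OF \<tau>s(1)[of i]]
      show "AE \<omega> in M. nn_cond_exp M (pre_sigma \<sigma>) (\<lambda>\<omega>. ?r \<omega> + ?E (\<tau>s i) \<omega>) \<omega> \<le> W \<omega>"
        by eventually_elim simp
    qed
    ultimately show ?R using R by eventually_elim (auto intro: SUP_least)
  next
    assume ?R
    show ?L
    proof
      fix \<tau>s assume \<tau>s: "\<tau>s \<in> ?S"
      have "AE \<omega> in M. ?r \<omega> + ?E \<tau>s \<omega> \<le> ?r \<omega> + ?Z \<omega>"
        using nn_cond_exp_le_val[OF m(1) \<tau>s] by eventually_elim (rule add_left_mono)
      then have "AE \<omega> in M. nn_cond_exp M (pre_sigma \<sigma>) (\<lambda>\<omega>. ?r \<omega> + ?E \<tau>s \<omega>) \<omega>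
          \<le> nn_cond_exp M (pre_sigma \<sigma>) (\<lambda>\<omega>. ?r \<omega> + ?Z \<omega>) \<omega>"
        by (rule S.nn_cond_exp_mono) measurable
      with \<open>?R\<close> R L[OF \<tau>s]
      show "AE \<omega> in M. nn_cond_exp M (pre_sigma \<sigma>) (total_reward Y (\<tau> # \<tau>s)) \<omega> \<le> W \<omega>"
        by eventually_elim simp
    qed
  qed
qed

text \<open>The set \<open>T\<close> of admissible first stops covers both claims at once, since
  countable range is required of the first stop only.\<close>

lemma ess_sup_strategies_eq:
  assumes \<sigma>: "stopping_time F \<sigma>" and T: "T \<subseteq> stopping_times_ge (space M) F \<sigma>"
    and n: "n \<ge> 1" "length \<delta> = n - 1" "set \<delta> \<subseteq> borel_measurable M"
  shows "AE \<omega> in M.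
    ess_sup M {nn_cond_exp M (pre_sigma \<sigma>) (total_reward Y \<tau>s) | \<tau>s.
      \<tau>s \<in> strategies (space M) n \<delta> F \<sigma> \<and> \<tau>s ! 0 \<in> T} \<omega> =
    ess_sup M {nn_cond_exp M (pre_sigma \<sigma>)
      (\<lambda>\<omega>. reward Y (\<tau> \<omega>) \<omega> + nn_cond_exp M (pre_sigma \<tau>)
        (val M Y (n - 1) (tl \<delta>) (enlarge (space M) F (\<lambda>\<omega>. \<tau> \<omega> + hd \<delta> \<omega>))
          (\<lambda>\<omega>. \<tau> \<omega> + hd \<delta> \<omega>)) \<omega>) | \<tau>. \<tau> \<in> T} \<omega>"
    (is "AE \<omega> in M. ess_sup M ?\<Phi> \<omega> = ess_sup M {?R \<tau> | \<tau>. \<tau> \<in> T} \<omega>")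
proof (rule ess_sup_AE_eqI)
  show "?\<Phi> \<subseteq> borel_measurable M" "{?R \<tau> | \<tau>. \<tau> \<in> T} \<subseteq> borel_measurable M"
    by (blast intro: borel_measurable_nn_cond_exp2)+
  let ?S = "\<lambda>\<tau>s. nn_cond_exp M (pre_sigma \<sigma>) (total_reward Y \<tau>s)"
  fix W :: "'a \<Rightarrow> ennreal"
  show "(\<forall>X\<in>?\<Phi>. AE \<omega> in M. X \<omega> \<le> W \<omega>) \<longleftrightarrow> (\<forall>X\<in>{?R \<tau> | \<tau>. \<tau> \<in> T}. AE \<omega> in M. X \<omega> \<le> W \<omega>)"
  proof (cases \<delta>)
    \<comment> \<open>Here \<open>n = 1\<close> and \<open>hd \<delta>\<close> is unspecified, but
      \<open>val\<close> with no stops left is the zero function whatever its arguments, and its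
      conditional expectation vanishes almost surely.\<close>
    case Nil
    then have n1: "n = 1" using n by simp
    interpret SF: subfiltration M F by (rule subfiltration_F)
    interpret S: sigma_finite_subalgebra M "pre_sigma \<sigma>"
      by (rule sigma_finite_subalgebra_if_subalgebra[OF SF.subalgebra_pre_sigma[OF \<sigma>]])
    have eq: "(AE \<omega> in M. ?S [\<tau>] \<omega> \<le> W \<omega>) \<longleftrightarrow> (AE \<omega> in M. ?R \<tau> \<omega> \<le> W \<omega>)" if "\<tau> \<in> T" for \<tau>
    proof -
      have \<tau>: "stopping_time F \<tau>" using that T by (auto simp: stopping_times_ge_def)
      interpret U: sigma_finite_subalgebra M "pre_sigma \<tau>"
        by (rule sigma_finite_subalgebra_if_subalgebra[OF SF.subalgebra_pre_sigma[OF \<tau>]])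
      have [measurable]: "(\<lambda>\<omega>. reward Y (\<tau> \<omega>) \<omega>) \<in> borel_measurable M"
        by (rule borel_measurable_reward[OF SF.borel_measurable_stopping_time[OF \<tau>]])
      have [measurable]: "total_reward Y [\<tau>] \<in> borel_measurable M"
        by (rule borel_measurable_total_reward) (simp add: SF.borel_measurable_stopping_time[OF \<tau>])
      have "AE \<omega> in M. total_reward Y [\<tau>] \<omega> =
          reward Y (\<tau> \<omega>) \<omega> + nn_cond_exp M (pre_sigma \<tau>) (\<lambda>_. 0) \<omega>"
        using U.nn_cond_exp_F_meas[of "\<lambda>_. 0", simplified]
        by eventually_elim (simp add: total_reward_def)
      then have "AE \<omega> in M. ?S [\<tau>] \<omega> = ?R \<tau> \<omega>"
        unfolding n1 val_def by (intro S.nn_cond_exp_cong) simp_all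
      then have "AE \<omega> in M. (?S [\<tau>] \<omega> \<le> W \<omega>) = (?R \<tau> \<omega> \<le> W \<omega>)" by eventually_elim simp
      \<comment> \<open>The almost sure equivalence of the two inequalities gives the equivalence of
        their holding almost surely.\<close>
      then show ?thesis by (rule eventually_subst)
    qed
    have "?\<Phi> = {?S [\<tau>] | \<tau>. \<tau> \<in> T}" unfolding n1 strategies_1 using T by fastforce
    then show ?thesis using eq by auto
  next
    case (Cons d \<gamma>)
    then obtain m where m: "n = Suc m" "m \<ge> 1" "length \<gamma> = m - 1"
      using n by (cases n) auto
    let ?C = "\<lambda>\<tau>. strategies (space M) m \<gamma> (enlarge (space M) F (\<lambda>\<omega>. \<tau> \<omega> + d \<omega>)) (\<lambda>\<omega>. \<tau> \<omega> + d \<omega>)"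
    have "\<tau>s \<in> strategies (space M) n \<delta> F \<sigma> \<and> \<tau>s ! 0 \<in> T \<longleftrightarrow> (\<exists>\<tau>\<in>T. \<exists>\<tau>s'\<in>?C \<tau>. \<tau>s = \<tau> # \<tau>s')" for \<tau>s
    proof (cases \<tau>s)
      case Nil
      then show ?thesis by (simp add: m(1) strategies_def)
    next
      case (Cons \<tau> \<tau>s')
      then show ?thesis
        unfolding m(1) \<open>\<delta> = d # \<gamma>\<close> strategies_Suc[OF m(2)] using T by (simp add: subset_iff) blast
    qed
    then have "?\<Phi> = {?S \<tau>s | \<tau>s. \<exists>\<tau>\<in>T. \<exists>\<tau>s'\<in>?C \<tau>. \<tau>s = \<tau> # \<tau>s'}" by (simp only:)
    then have "(\<forall>X\<in>?\<Phi>. AE \<omega> in M. X \<omega> \<le> W \<omega>) \<longleftrightarrow>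
        (\<forall>\<tau>\<in>T. \<forall>\<tau>s\<in>?C \<tau>. AE \<omega> in M. ?S (\<tau> # \<tau>s) \<omega> \<le> W \<omega>)"
      by (simp only:) blast
    also have "\<dots> \<longleftrightarrow> (\<forall>\<tau>\<in>T. AE \<omega> in M. ?R \<tau> \<omega> \<le> W \<omega>)"
    proof (rule ball_cong[OF refl])
      fix \<tau> assume "\<tau> \<in> T"
      with T have "\<tau> \<in> stopping_times_ge (space M) F \<sigma>" by blast
      from continuation_le_iff[OF \<sigma> this m(2,3), of d W] n(3)
      show "(\<forall>\<tau>s\<in>?C \<tau>. AE \<omega> in M. ?S (\<tau> # \<tau>s) \<omega> \<le> W \<omega>) \<longleftrightarrow> (AE \<omega> in M. ?R \<tau> \<omega> \<le> W \<omega>)"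
        by (simp add: Cons m(1))
    qed
    finally show ?thesis by blast
  qed
qed

end

theorem theorem3p2:
  fixes M :: "'a measure" and F :: "ennreal \<Rightarrow> 'a measure" and Y :: "real \<Rightarrow> 'a \<Rightarrow> real"
    and n :: nat and \<delta> :: "('a \<Rightarrow> ennreal) list" and \<sigma> :: "'a \<Rightarrow> ennreal"
  assumes "reward_process M F Y"
    and "n \<ge> 1"
    and "length \<delta> = n - 1"
    and "\<And>d. d \<in> set \<delta> \<Longrightarrow> d \<in> borel_measurable M"
    and "\<And>d. d \<in> set \<delta> \<Longrightarrow> AE \<omega> in M. d \<omega> < \<infinity>"
    and "stopping_time F \<sigma>"
  shows
    "(AE \<omega> in M. val M Y n \<delta> F \<sigma> \<omega> =
        ess_sup M {nn_cond_exp M (stopped_sigma M F \<sigma>)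
            (\<lambda>\<omega>. reward Y (\<tau> \<omega>) \<omega> + nn_cond_exp M (stopped_sigma M F \<tau>)
               (val M Y (n - 1) (tl \<delta>) (enlarge (space M) F (\<lambda>\<omega>. \<tau> \<omega> + hd \<delta> \<omega>))
                  (\<lambda>\<omega>. \<tau> \<omega> + hd \<delta> \<omega>)) \<omega>) | \<tau>.
          \<tau> \<in> stopping_times_ge (space M) F \<sigma>} \<omega>) \<and>
     (AE \<omega> in M. val_disc M Y n \<delta> F \<sigma> \<omega> =
        ess_sup M {nn_cond_exp M (stopped_sigma M F \<sigma>)
            (\<lambda>\<omega>. reward Y (\<tau> \<omega>) \<omega> + nn_cond_exp M (stopped_sigma M F \<tau>)
               (val M Y (n - 1) (tl \<delta>) (enlarge (space M) F (\<lambda>\<omega>. \<tau> \<omega> + hd \<delta> \<omega>))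
                  (\<lambda>\<omega>. \<tau> \<omega> + hd \<delta> \<omega>)) \<omega>) | \<tau>.
          \<tau> \<in> stopping_times_ge_disc (space M) F \<sigma>} \<omega>)"
proof -
  interpret reward_process M F Y by fact
  let ?E = "\<lambda>\<tau>s. nn_cond_exp M (pre_sigma \<sigma>) (total_reward Y \<tau>s)"
  have first: "\<tau>s ! 0 \<in> stopping_times_ge (space M) F \<sigma>"
    if "\<tau>s \<in> strategies (space M) n \<delta> F \<sigma>" for \<tau>s
    using that by (simp add: strategies_def stopping_times_ge_def)
  \<comment> \<open>The first stop of a strategy always lies in \<open>stopping_times_ge\<close>, so
    adding this condition brings the value into the form with \<open>T\<close>.\<close>
  have "val M Y n \<delta> F \<sigma> = ess_sup M {?E \<tau>s | \<tau>s. \<tau>s \<in> strategies (space M) n \<delta> F \<sigma> \<and>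
      \<tau>s ! 0 \<in> stopping_times_ge (space M) F \<sigma>}"
    using \<open>n \<ge> 1\<close> first by (auto simp: val_def cong: conj_cong intro!: arg_cong[of _ _ "ess_sup M"])
  moreover have "val_disc M Y n \<delta> F \<sigma> = ess_sup M {?E \<tau>s | \<tau>s. \<tau>s \<in> strategies (space M) n \<delta> F \<sigma> \<and>
      \<tau>s ! 0 \<in> stopping_times_ge_disc (space M) F \<sigma>}"
    using \<open>n \<ge> 1\<close> first
    by (auto simp: val_disc_def strategies_disc_def stopping_times_ge_disc_def intro!: arg_cong[of _ _ "ess_sup M"])
  moreover have "set \<delta> \<subseteq> borel_measurable M" using assms(4) by blast
  ultimately show ?thesis
    using ess_sup_strategies_eq[OF assms(6) order_refl assms(2,3)]
      ess_sup_strategies_eq[OF assms(6) _ assms(2,3), of "stopping_times_ge_disc (space M) F \<sigma>"]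
    by (simp only:) (auto simp: stopping_times_ge_disc_def)
qed

end
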